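(* Let $n\ge 2$ and let an almost symmetric numerical semigroup $S=S(\mathbf d^{2n})$, minimally generated by $\mathbf d^{2n}=\{d_1,\dots,d_{2n}\}$, be given, with Betti numbers $\beta_i=\beta_i(\mathbf d^{2n})$, $\gamma=\#\Delta_{\mathcal H}$, and $\delta=\wp-\ell$ (all defined in the context). Then $$\beta_1+\beta_3+\dots+\beta_{2n-3}=\gamma\cdot\left(4^{n-1}-1\right)+\tfrac12\,\delta,$$ $$\beta_2+\beta_4+\dots+\beta_{2n-2}=\gamma\cdot 4^{n-1}+\tfrac12\,\delta.$$
   Context: Semigroup. Let $m=2n$ and let $d_1<\dots<d_m$ be positive integers with $\gcd(d_1,\dots,d_m)=1$, none a nonnegative integer linear combination of the others, $S=\{\sum_{i=1}^m x_id_i : x_i\in\mathbb Z_{\ge 0}\}$, $F$ the largest integer not in $S$, $\Sigma_m=\sum_{k=1}^m d_k$. Put $S'=\{x\in\mathbb Z : x\notin S,\ x+s\in S \text{ for all } s\in S\setminus\{0\}\}$ and $\Delta_{\mathcal H}=\{h\notin S : F-h\notin S\}$, $\gamma=\#\Delta_{\mathcal H}$. $S$ is almost symmetric if $S'\setminus\{F\}=\Delta_{\mathcal H}$. Syzygies. Let $k$ be a field of characteristic $0$, and regard $k[z^{d_1},\dots,z^{d_m}]$ as a graded module over $k[X_1,\dots,X_m]$, $\deg X_i=d_i$, via $X_i\mapsto z^{d_i}$. Its Hilbert series is written $\sum_{s\in S}z^s=Q(z)/\prod_{j=1}^m(1-z^{d_j})$ with $Q=1-Q_1+Q_2-\dots+(-1)^{m-1}Q_{m-1}$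 and $Q_i(z)=\sum_{j=1}^{\beta_i}z^{C_{j,i}}$ for $1\le i\le m-1$. The summands $z^{C_{j,i}}$ stand for the syzygies of the $i$th kind (those of the $i$th step of the minimal graded free resolution); the positive integers $C_{j,i}$ are the syzygy degrees and the numbers $\beta_i$ of terms the Betti numbers. They are subject to the standing requirements $C_{j+1,i}\ge C_{j,i}$, $C_{\beta_{i+1},i+1}>C_{\beta_i,i}$, $C_{1,i+1}>C_{1,i}$, and $$C_{j,i}\ne C_{r,i+2k-1}\quad\text{for } 1\le j\le\beta_i,\ 1\le r\le\beta_{i+2k-1},\ 1\le k\le\lfloor (m-i)/2\rfloor ;$$ the last requirement means that all necessary cancellations of terms $z^{C_{j,i}}$ in the alternating sum $Q$ are already performed. Put $\overline C_{j,i}=F+\Sigma_m-C_{j,i}$. Multiset operations. For finite multisets of integers with multiplicity functions $\sigma_1,\sigma_2$: $\bigvee$ (join) has multiplicity $\sigma_1+\sigma_2$; $\bigwedge$ (intersection) has multiplicity $\min\{\sigma_1,\sigma_2\}$; $\#$ denotes cardinality counted with multiplicity. Multisets. For $1\le i\le m-1$ let $\mathfrak L_i$ be the multiset of all integers $\sum_{j\in I}d_j+h$, where $I$ runs over the $i$-element subsets of $\{1,\dots,m\}$ and $h$ over $\Delta_{\mathcal H}$, counted with multiplicity. $\mathfrak L_o$ (resp. $\mathfrak L_e$) is the join of all $\mathfrak L_i$ with $i$ odd (resp. even), $1\le i\le m-1$. Let $\mathfrak B_i=\{C_{j,i}:1\le j\le\beta_i\}$ and $\overline{\mathfrak B}_i=\{\overline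 C_{j,i}:1\le j\le\beta_i\}$ as multisets, $\mathfrak B_o=\bigvee_{i=1}^{n-1}\mathfrak B_{2i-1}$, $\mathfrak B_e=\bigvee_{i=1}^{n-1}\mathfrak B_{2i}$, $\overline{\mathfrak B}_o=\bigvee_{i=1}^{n-1}\overline{\mathfrak B}_{2i-1}$, $\overline{\mathfrak B}_e=\bigvee_{i=1}^{n-1}\overline{\mathfrak B}_{2i}$. Put $\ell=\#\left(\mathfrak L_e\bigwedge\mathfrak L_o\right)$, $\wp=\#\left(\left[\mathfrak B_o\bigvee\overline{\mathfrak B}_o\right]\bigwedge\left[\mathfrak B_e\bigvee\overline{\mathfrak B}_e\right]\right)$, $\delta=\wp-\ell$. *)

theory Defs
  imports Complex_Main "HOL-Library.Multiset" "HOL-Library.Poly_Mapping"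
    "HOL-Computational_Algebra.Polynomial"
begin

definition semigroup_of :: "nat \<Rightarrow> (nat \<Rightarrow> nat) \<Rightarrow> int set" where
  "semigroup_of m d = {int (\<Sum>i=1..m. x i * d i) | x :: nat \<Rightarrow> nat. True}"

definition minimally_generating :: "nat \<Rightarrow> (nat \<Rightarrow> nat) \<Rightarrow> bool" where
  "minimally_generating m d \<longleftrightarrow>
     (\<forall>i\<in>{1..m}. 0 < d i) \<and>
     strict_mono_on {1..m} d \<and>
     Gcd (d ` {1..m}) = 1 \<and>
     (\<forall>i\<in>{1..m}. \<not> (\<exists>x :: nat \<Rightarrow> nat. d i = (\<Sum>j\<in>{1..m} - {i}. x j * d j)))"

definition frobenius :: "nat \<Rightarrow> (nat \<Rightarrow> nat) \<Rightarrow> int" where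
  "frobenius m d = (GREATEST x. x \<notin> semigroup_of m d)"

definition pseudo_frobenius :: "nat \<Rightarrow> (nat \<Rightarrow> nat) \<Rightarrow> int set" where
  "pseudo_frobenius m d =
     {x. x \<notin> semigroup_of m d \<and> (\<forall>s \<in> semigroup_of m d - {0}. x + s \<in> semigroup_of m d)}"

text \<open>If \<open>d\<close> generates a proper numerical semigroup, the greatest gap exists, every gap \<open>h\<close> in
  \<open>\<Delta>H m d\<close> satisfies \<open>0 < h < frobenius m d\<close>, and so \<open>\<Delta>H m d\<close> is finite.\<close>

definition \<Delta>H :: "nat \<Rightarrow> (nat \<Rightarrow> nat) \<Rightarrow> int set" where
  "\<Delta>H m d = {h. h \<notin> semigroup_of m d \<and> frobenius m d - h \<notin> semigroup_of m d}"

definition \<gamma>H :: "nat \<Rightarrow> (nat \<Rightarrow> nat) \<Rightarrow> nat" where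
  "\<gamma>H m d = card (\<Delta>H m d)"

definition almost_symmetric :: "nat \<Rightarrow> (nat \<Rightarrow> nat) \<Rightarrow> bool" where
  "almost_symmetric m d \<longleftrightarrow> pseudo_frobenius m d - {frobenius m d} = \<Delta>H m d"

definition gen_sum :: "nat \<Rightarrow> (nat \<Rightarrow> nat) \<Rightarrow> int" where
  "gen_sum m d = (\<Sum>k=1..m. int (d k))"

text \<open>Polynomials are finitely supported maps from exponent vectors to coefficients;
  \<open>poly_ring m\<close> is the ring in the variables with indices in \<open>{1..m}\<close>.\<close>

type_synonym 'k mpol = "(nat \<Rightarrow>\<^sub>0 nat) \<Rightarrow>\<^sub>0 'k"

definition poly_ring :: "nat \<Rightarrow> ('k::field_char_0) mpol set" where
  "poly_ring m = {p. \<forall>t \<in> Poly_Mapping.keys p. Poly_Mapping.keys t \<subseteq> {1..m}}"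

definition wdeg :: "nat \<Rightarrow> (nat \<Rightarrow> nat) \<Rightarrow> (nat \<Rightarrow>\<^sub>0 nat) \<Rightarrow> nat" where
  "wdeg m d t = (\<Sum>i=1..m. Poly_Mapping.lookup t i * d i)"

text \<open>The \<open>k\<close>-algebra homomorphism sending the \<open>i\<close>-th variable to \<open>z ^ d i\<close>. Its image on
  \<open>poly_ring m\<close> is, by definition, the semigroup ring; so only its kernel matters below.\<close>

definition subst_map :: "nat \<Rightarrow> (nat \<Rightarrow> nat) \<Rightarrow> ('k::field_char_0) mpol \<Rightarrow> 'k poly" where
  "subst_map m d p =
     (\<Sum>t\<in>Poly_Mapping.keys p.
        smult (Poly_Mapping.lookup p t) (\<Prod>i=1..m. (monom 1 (d i)) ^ Poly_Mapping.lookup t i))"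

definition free_module :: "nat \<Rightarrow> nat \<Rightarrow> (nat \<Rightarrow> ('k::field_char_0) mpol) set" where
  "free_module m b = {v. (\<forall>j\<in>{1..b}. v j \<in> poly_ring m) \<and> (\<forall>j. j \<notin> {1..b} \<longrightarrow> v j = 0)}"

definition mat_map ::
  "nat \<Rightarrow> nat \<Rightarrow> (nat \<Rightarrow> nat \<Rightarrow> ('k::field_char_0) mpol) \<Rightarrow> (nat \<Rightarrow> 'k mpol) \<Rightarrow> (nat \<Rightarrow> 'k mpol)" where
  "mat_map a b A v = (\<lambda>r. if r \<in> {1..a} then (\<Sum>j=1..b. A r j * v j) else 0)"

text \<open>\<open>0 \<rightarrow> F\<^sub>m\<^sub>-\<^sub>1 \<rightarrow> \<dots> \<rightarrow> F\<^sub>1 \<rightarrow> F\<^sub>0 \<rightarrow> k[z^d\<^sub>1, \<dots>, z^d\<^sub>m] \<rightarrow> 0\<close>, where \<open>F\<^sub>i\<close> is free on \<open>\<beta> i\<close>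
  homogeneous generators of degrees \<open>C 1 i, \<dots>, C (\<beta> i) i\<close> and \<open>F\<^sub>0\<close> is the polynomial ring.
  The map \<open>F\<^sub>i \<rightarrow> F\<^sub>i\<^sub>-\<^sub>1\<close> is given by the matrix \<open>\<phi> i\<close>. It preserves degrees iff the entry in
  row \<open>r\<close> and column \<open>j\<close> is homogeneous of degree \<open>C j i - C r (i - 1)\<close>. Minimality says that
  the image lies in the irrelevant maximal ideal times \<open>F\<^sub>i\<^sub>-\<^sub>1\<close>, i.e. no entry has a constant term.\<close>

definition minimal_graded_free_resolution ::
  "nat \<Rightarrow> (nat \<Rightarrow> nat) \<Rightarrow> (nat \<Rightarrow> nat) \<Rightarrow> (nat \<Rightarrow> nat \<Rightarrow> nat) \<Rightarrow>
   (nat \<Rightarrow> nat \<Rightarrow> nat \<Rightarrow> ('k::field_char_0) mpol) \<Rightarrow> bool" where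
  "minimal_graded_free_resolution m d \<beta> C \<phi> \<longleftrightarrow>
     \<beta> 0 = 1 \<and> C 1 0 = 0 \<and>
     (\<forall>i\<in>{1..m-1}. \<forall>r\<in>{1..\<beta> (i-1)}. \<forall>j\<in>{1..\<beta> i}.
        \<phi> i r j \<in> poly_ring m \<and>
        (\<forall>t\<in>Poly_Mapping.keys (\<phi> i r j). wdeg m d t + C r (i-1) = C j i) \<and>
        Poly_Mapping.lookup (\<phi> i r j) 0 = 0) \<and>
     mat_map (\<beta> 0) (\<beta> 1) (\<phi> 1) ` free_module m (\<beta> 1)
       = {v \<in> free_module m (\<beta> 0). subst_map m d (v 1) = 0} \<and>
     (\<forall>i\<in>{1..<m-1}.
        mat_map (\<beta> i) (\<beta> (i+1)) (\<phi> (i+1)) ` free_module m (\<beta> (i+1))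
          = {v \<in> free_module m (\<beta> i). mat_map (\<beta> (i-1)) (\<beta> i) (\<phi> i) v = (\<lambda>_. 0)}) \<and>
     {v \<in> free_module m (\<beta> (m-1)). mat_map (\<beta> (m-2)) (\<beta> (m-1)) (\<phi> (m-1)) v = (\<lambda>_. 0)}
       = {\<lambda>_. 0}"

definition syzygy_degree_requirements :: "nat \<Rightarrow> (nat \<Rightarrow> nat) \<Rightarrow> (nat \<Rightarrow> nat \<Rightarrow> nat) \<Rightarrow> bool" where
  "syzygy_degree_requirements m \<beta> C \<longleftrightarrow>
     (\<forall>i\<in>{1..m-1}. \<forall>j\<in>{1..\<beta> i}. 0 < C j i) \<and>
     (\<forall>i\<in>{1..m-1}. \<forall>j\<in>{1..<\<beta> i}. C (j+1) i \<ge> C j i) \<and>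
     (\<forall>i\<in>{1..<m-1}. C (\<beta> (i+1)) (i+1) > C (\<beta> i) i) \<and>
     (\<forall>i\<in>{1..<m-1}. C 1 (i+1) > C 1 i) \<and>
     (\<forall>i\<in>{1..m-1}. \<forall>k\<in>{1..(m-i) div 2}. \<forall>j\<in>{1..\<beta> i}. \<forall>r\<in>{1..\<beta> (i+2*k-1)}.
        C j i \<noteq> C r (i+2*k-1))"

definition Lms :: "nat \<Rightarrow> (nat \<Rightarrow> nat) \<Rightarrow> nat \<Rightarrow> int multiset" where
  "Lms m d i = image_mset (\<lambda>(I, h). (\<Sum>j\<in>I. int (d j)) + h)
     (mset_set ({I. I \<subseteq> {1..m} \<and> card I = i} \<times> \<Delta>H m d))"

definition Lms_odd :: "nat \<Rightarrow> (nat \<Rightarrow> nat) \<Rightarrow> int multiset" where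
  "Lms_odd m d = (\<Sum>i\<in>{i\<in>{1..m-1}. odd i}. Lms m d i)"

definition Lms_even :: "nat \<Rightarrow> (nat \<Rightarrow> nat) \<Rightarrow> int multiset" where
  "Lms_even m d = (\<Sum>i\<in>{i\<in>{1..m-1}. even i}. Lms m d i)"

definition Bms :: "(nat \<Rightarrow> nat) \<Rightarrow> (nat \<Rightarrow> nat \<Rightarrow> nat) \<Rightarrow> nat \<Rightarrow> int multiset" where
  "Bms \<beta> C i = image_mset (\<lambda>j. int (C j i)) (mset_set {1..\<beta> i})"

definition Bms_bar ::
  "nat \<Rightarrow> (nat \<Rightarrow> nat) \<Rightarrow> (nat \<Rightarrow> nat) \<Rightarrow> (nat \<Rightarrow> nat \<Rightarrow> nat) \<Rightarrow> nat \<Rightarrow> int multiset" where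
  "Bms_bar m d \<beta> C i =
     image_mset (\<lambda>j. frobenius m d + gen_sum m d - int (C j i)) (mset_set {1..\<beta> i})"

definition ell :: "nat \<Rightarrow> (nat \<Rightarrow> nat) \<Rightarrow> nat" where
  "ell n d = size (Lms_even (2*n) d \<inter># Lms_odd (2*n) d)"

definition wp :: "nat \<Rightarrow> (nat \<Rightarrow> nat) \<Rightarrow> (nat \<Rightarrow> nat) \<Rightarrow> (nat \<Rightarrow> nat \<Rightarrow> nat) \<Rightarrow> nat" where
  "wp n d \<beta> C = size
     (((\<Sum>i=1..n-1. Bms \<beta> C (2*i-1)) + (\<Sum>i=1..n-1. Bms_bar (2*n) d \<beta> C (2*i-1))) \<inter>#
      ((\<Sum>i=1..n-1. Bms \<beta> C (2*i)) + (\<Sum>i=1..n-1. Bms_bar (2*n) d \<beta> C (2*i))))"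

definition delta :: "nat \<Rightarrow> (nat \<Rightarrow> nat) \<Rightarrow> (nat \<Rightarrow> nat) \<Rightarrow> (nat \<Rightarrow> nat \<Rightarrow> nat) \<Rightarrow> int" where
  "delta n d \<beta> C = int (wp n d \<beta> C) - int (ell n d)"

end

theory Submission
  imports Defs "HOL-Library.Function_Algebras"
begin

text \<open>
  Every integer \<open>x\<close> satisfies exactly one of \<open>x \<in> S\<close>, \<open>F - x \<in> S\<close>, \<open>x \<in> \<Delta>H\<close>. Multiplying the three
  indicator series by \<open>\<Prod>\<^sub>j (1 - z ^ d\<^sub>j)\<close>, which annihilates \<open>\<Sum>\<^sub>x z ^ x\<close>, gives for even \<open>m\<close>
  \<open>Q(z) + z ^ (F + \<Sigma>) Q(1/z) = - \<Delta>H(z) \<Prod>\<^sub>j (1 - z ^ d\<^sub>j)\<close>.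
  Almost symmetry determines the last syzygy degrees: they are the numbers \<open>f + \<Sigma>\<close> with \<open>f\<close> pseudo-Frobenius,
  i.e. \<open>f = F\<close> or \<open>f \<in> \<Delta>H\<close>. Removing the zeroth and the last step on the left and the
  summands of \<open>I = {}\<close> and \<open>I = {1..m}\<close> on the right leaves
  \<open>B\<^sub>o + B'\<^sub>o + L\<^sub>o = B\<^sub>e + B'\<^sub>e + L\<^sub>e\<close> (\<open>'\<close> for the reflected multisets), and the claim follows by cancelling common
  elements and counting.

  The last syzygy degrees are those of \<open>Tor\<^sub>m\<^sub>-\<^sub>1(k[S], k)\<close>. With \<open>E = k[z, 1/z]\<close>, on which all variables act
  invertibly, this is the socle of \<open>E / k[S]\<close>, shifted by \<open>\<Sigma>\<close>, and the socle has the basis \<open>z ^ f\<close>, \<open>f\<close> pseudo-Frobenius.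
  The isomorphism is made explicit by zigzags through the double complex of the resolution and the Koszul complex.
\<close>

section \<open>Rank and nullity\<close>

text \<open>A resolution is given, but neither its Hilbert numerator nor its last degrees; both are
  derived from exactness. For the numerator this is rank and nullity in each degree. For the last
  degrees, exactness of the resolution moves a chain one way along a zigzag and exactness of the
  Koszul complex moves it back. The Koszul complex is exact only up to constant terms at
  \<open>{}\<close>. By minimality the maps of the resolution never produce such terms, so the
  obstruction shows up at the last module alone, where it records the coefficients of the basis
  vectors. Zigzags depend on choices, so no map on homology is defined: the property
  \<open>trivial\<close> is transported along them, and homogeneity is restored by projecting to one
  degree.

  The balance equation only determines differences of multiplicities. Elements common to both of its
  sides are invisible to it; their numbers \<open>wp\<close> and \<open>ell\<close> therefore enter
  the result, through \<open>delta\<close>. Degrees and reflected degrees are counted together, so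
  each Betti number occurs twice, whence the half of \<open>delta\<close>.\<close>

lemma (in vector_space_pair) dim_eq_dim_image_plus_dim_kernel:
  assumes f: "Vector_Spaces.linear s1 s2 f" and V: "vs1.subspace V" "V \<subseteq> vs1.span W" "finite W"
  shows "vs1.dim V = vs2.dim (f ` V) + vs1.dim {x \<in> V. f x = 0}"
proof -
  let ?K = "{x \<in> V. f x = 0}"
  interpret f: Vector_Spaces.linear s1 s2 f by (rule f)
  obtain B where B: "B \<subseteq> ?K" "vs1.independent B" "?K \<subseteq> vs1.span B"
    using vs1.maximal_independent_subset[of ?K] by blast
  obtain B' where B': "B \<subseteq> B'" "B' \<subseteq> V" "vs1.independent B'" "V \<subseteq> vs1.span B'"
    using vs1.maximal_independent_subset_extend[of B V] B by blast
  have fin: "finite B'"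
    using vs1.independent_span_bound[OF V(3) B'(3)] B'(2) V(2) by blast
  have K: "?K = vs1.span B"
    using B V(1) f by (intro equalityI vs1.span_minimal) 
      (auto simp: vs1.subspace_def f.add f.scale f.zero)
  have dimK: "vs1.dim ?K = card B"
    unfolding K by (rule vs1.dim_span_eq_card_independent) (rule B)
  have dimV: "vs1.dim V = card B'"
    using vs1.basis_card_eq_dim[OF B'(2,4,3)] by simp
  let ?D = "B' - B"
  \<comment> \<open>Such an \<open>x\<close> has expansions over \<open>B\<close> and over
    \<open>B' - B\<close>; both are its unique expansion over \<open>B'\<close>, so no basis vector
    occurs in it.\<close>
  have indK: "x = 0" if x: "x \<in> vs1.span ?D" and fx: "f x = 0" for x
  proof -
    have "x \<in> V" using x vs1.span_minimal[OF _ V(1), of ?D] B'(2) by blast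
    moreover from this have "x \<in> vs1.span B" using fx K by auto
    ultimately have "x \<in> vs1.span B" "x \<in> vs1.span ?D" using x by blast+
    hence "vs1.representation B' x = vs1.representation B x"
      "vs1.representation B' x = vs1.representation ?D x"
      using B' by (auto intro: vs1.representation_extend)
    hence "vs1.representation B' x b = 0" for b
      by (metis DiffD2 vs1.representation_ne_zero)
    thus "x = 0"
      using vs1.sum_nonzero_representation_eq[OF B'(3), of x] B'(4) \<open>x \<in> V\<close> by auto
  qed
  have inj: "inj_on f (vs1.span ?D)"
    unfolding f.inj_on_iff_eq_0[OF vs1.subspace_span] using indK by blast
  have indD: "vs1.independent ?D"
    using B'(3) vs1.independent_mono by blast
  have indep: "vs2.independent (f ` ?D)"
    by (rule f.independent_injective_image[OF indD inj])
  have V_eq: "V = vs1.span B'"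
    using vs1.span_minimal[OF B'(2) V(1)] B'(4) by blast
  have fB: "f ` B \<subseteq> {0}" using B(1) by auto
  have "f ` V = vs2.span (f ` B')"
    unfolding V_eq f.span_image ..
  also have "\<dots> = vs2.span (f ` ?D)"
  proof (intro equalityI vs2.span_minimal vs2.subspace_span)
    have "f x \<in> vs2.span (f ` ?D)" if "x \<in> B'" for x
      using that fB by (cases "x \<in> B") (auto intro: vs2.span_base simp: vs2.span_zero)
    thus "f ` B' \<subseteq> vs2.span (f ` ?D)" by blast
  qed (auto intro: vs2.span_base)
  finally have "vs2.dim (f ` V) = card (f ` ?D)"
    using vs2.dim_span_eq_card_independent[OF indep] by simp
  also have "\<dots> = card ?D"
    by (intro card_image inj_on_subset[OF inj]) (auto intro: vs1.span_base)
  also have "\<dots> = card B' - card B"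
    using B'(1) fin by (simp add: card_Diff_subset finite_subset)
  finally show ?thesis
    using dimV dimK card_mono[OF fin B'(1)] by simp
qed

section \<open>Multiplication by the denominator of the Hilbert series\<close>

text \<open>The effect of multiplying \<open>\<Sum>\<^sub>x f x z ^ x\<close> by \<open>\<Prod>\<^sub>j\<^sub>\<in>\<^sub>A (1 - z ^ d j)\<close> on the coefficients. Using functions on
  the integers, bilateral series are allowed.\<close>

definition alt_shift :: "(nat \<Rightarrow> nat) \<Rightarrow> nat set \<Rightarrow> (int \<Rightarrow> int) \<Rightarrow> int \<Rightarrow> int" where
  "alt_shift d A f x = (\<Sum>I\<in>Pow A. (-1) ^ card I * f (x - (\<Sum>j\<in>I. int (d j))))"

lemma alt_shift_empty [simp]: "alt_shift d {} f x = f x"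
  by (simp add: alt_shift_def)

text \<open>The factor \<open>1 - z ^ d i\<close> is peeled off: adding \<open>i\<close> to a subset
  of \<open>A\<close> flips the sign and shifts the argument by \<open>d i\<close>.\<close>

lemma alt_shift_insert:
  assumes "finite A" "i \<notin> A"
  shows "alt_shift d (insert i A) f x = alt_shift d A (\<lambda>y. f y - f (y - int (d i))) x"
proof -
  have inj: "inj_on (insert i) (Pow A)"
    using assms(2) by (auto simp: inj_on_def)
  have disj: "Pow A \<inter> insert i ` Pow A = {}"
    using assms(2) by auto
  have *: "(-1) ^ card (insert i I) * f (x - (\<Sum>j\<in>insert i I. int (d j)))
      = - ((-1) ^ card I * f (x - (\<Sum>j\<in>I. int (d j)) - int (d i)))" if "I \<in> Pow A" for I
  proof -
    have "finite I" "i \<notin> I" using that assms by (auto intro: finite_subset)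
    thus ?thesis by (simp add: algebra_simps)
  qed
  have "alt_shift d (insert i A) f x =
     alt_shift d A f x + (\<Sum>I\<in>Pow A. (-1) ^ card (insert i I) * f (x - (\<Sum>j\<in>insert i I. int (d j))))"
    unfolding alt_shift_def Pow_insert
    by (subst sum.union_disjoint) (use assms disj inj in \<open>auto simp: sum.reindex\<close>)
  also have "(\<Sum>I\<in>Pow A. (-1) ^ card (insert i I) * f (x - (\<Sum>j\<in>insert i I. int (d j))))
     = - (\<Sum>I\<in>Pow A. (-1) ^ card I * f (x - (\<Sum>j\<in>I. int (d j)) - int (d i)))"
    by (simp add: * sum_negf)
  finally show ?thesis
    by (simp add: alt_shift_def sum_subtractf right_diff_distrib)
qed

text \<open>A single factor \<open>1 - z ^ d i\<close> already kills a constant bilateral series, so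
  one element of \<open>A\<close> is enough.\<close>

lemma alt_shift_const:
  assumes "finite A" "A \<noteq> {}"
  shows "alt_shift d A (\<lambda>_. c) x = 0"
proof -
  obtain i where "i \<in> A" using assms by blast
  hence "alt_shift d A (\<lambda>_. c) x = alt_shift d (insert i (A - {i})) (\<lambda>_. c) x"
    by (simp add: insert_absorb)
  also have "\<dots> = 0"
    using assms by (subst alt_shift_insert) (auto simp: alt_shift_def)
  finally show ?thesis .
qed

lemma alt_shift_diff: "alt_shift d A (\<lambda>y. f y - g y) x = alt_shift d A f x - alt_shift d A g x"
  by (simp add: alt_shift_def right_diff_distrib sum_subtractf)

lemma alt_shift_sum:
  "alt_shift d A (\<lambda>y. \<Sum>k\<in>K. u k * f k (y - v k)) x = (\<Sum>k\<in>K. u k * alt_shift d A (f k) (x - v k))"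
proof -
  have "alt_shift d A (\<lambda>y. \<Sum>k\<in>K. u k * f k (y - v k)) x =
    (\<Sum>I\<in>Pow A. \<Sum>k\<in>K. u k * ((-1) ^ card I * f k (x - v k - (\<Sum>j\<in>I. int (d j)))))"
    unfolding alt_shift_def sum_distrib_left
    by (intro sum.cong refl) (simp add: diff_diff_eq add.commute mult.left_commute)
  also have "\<dots> = (\<Sum>k\<in>K. u k * alt_shift d A (f k) (x - v k))"
    unfolding alt_shift_def sum_distrib_left by (rule sum.swap)
  finally show ?thesis .
qed

text \<open>Substituting \<open>1/z\<close> in the product reproduces it up to a sign and a power of
  \<open>z\<close>; on the level of subsets this is passing to complements.\<close>

lemma alt_shift_reflect:
  assumes "finite A"
  shows "alt_shift d A (\<lambda>y. f (a - y)) x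
     = (-1) ^ card A * alt_shift d A f (a + (\<Sum>j\<in>A. int (d j)) - x)"
proof -
  have "alt_shift d A (\<lambda>y. f (a - y)) x
     = (\<Sum>I\<in>Pow A. (-1) ^ card (A - I) * f (a - (x - (\<Sum>j\<in>A - I. int (d j)))))"
    unfolding alt_shift_def
    by (rule sum.reindex_bij_witness[where i = "\<lambda>I. A - I" and j = "\<lambda>I. A - I"])
       (auto simp: double_diff)
  also have "\<dots> = (\<Sum>I\<in>Pow A. (-1) ^ card A *
      ((-1) ^ card I * f (a + (\<Sum>j\<in>A. int (d j)) - x - (\<Sum>j\<in>I. int (d j)))))"
  proof (rule sum.cong)
    fix I assume I: "I \<in> Pow A"
    hence fin: "finite I" using assms finite_subset by auto
    have "card A = card (A - I) + card I"
      using I fin assms by (simp add: card_Diff_subset card_mono)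
    hence "(-1 :: int) ^ card A * (-1) ^ card I = (-1) ^ card (A - I) * ((-1) ^ card I * (-1) ^ card I)"
      by (simp add: power_add)
    hence sign: "(-1 :: int) ^ card A * (-1) ^ card I = (-1) ^ card (A - I)"
      by (simp flip: power_mult_distrib)
    have "(\<Sum>j\<in>A - I. int (d j)) = (\<Sum>j\<in>A. int (d j)) - (\<Sum>j\<in>I. int (d j))"
      using I assms by (intro sum_diff) auto
    hence arg: "a - (x - (\<Sum>j\<in>A - I. int (d j))) = a + (\<Sum>j\<in>A. int (d j)) - x - (\<Sum>j\<in>I. int (d j))"
      by linarith
    show "(-1) ^ card (A - I) * f (a - (x - (\<Sum>j\<in>A - I. int (d j)))) = (-1) ^ card A *
      ((-1) ^ card I * f (a + (\<Sum>j\<in>A. int (d j)) - x - (\<Sum>j\<in>I. int (d j))))"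
      unfolding mult.assoc[symmetric] sign arg ..
  qed simp
  finally show ?thesis unfolding alt_shift_def by (simp add: sum_distrib_left)
qed

section \<open>The Hilbert series of the polynomial ring\<close>

definition monomials_of_degree :: "(nat \<Rightarrow> nat) \<Rightarrow> nat set \<Rightarrow> int \<Rightarrow> (nat \<Rightarrow>\<^sub>0 nat) set" where
  "monomials_of_degree d A x =
     {t. Poly_Mapping.keys t \<subseteq> A \<and> int (\<Sum>i\<in>A. Poly_Mapping.lookup t i * d i) = x}"

lemma finite_monomials_of_degree:
  assumes A: "finite A" and pos: "\<And>i. i \<in> A \<Longrightarrow> 0 < d i"
  shows "finite (monomials_of_degree d A x)"
proof (rule finite_imageD)
  let ?f = "\<lambda>t i. if i \<in> A then Poly_Mapping.lookup t i else 0"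
  have "?f ` monomials_of_degree d A x \<subseteq> {f. \<forall>i. (i \<in> A \<longrightarrow> f i \<in> {..nat x}) \<and> (i \<notin> A \<longrightarrow> f i = 0)}"
  proof clarsimp
    fix t i assume t: "t \<in> monomials_of_degree d A x" and i: "i \<in> A"
    have "Poly_Mapping.lookup t i \<le> Poly_Mapping.lookup t i * d i" using pos[OF i] by simp
    also have "\<dots> \<le> (\<Sum>i\<in>A. Poly_Mapping.lookup t i * d i)"
      using A i by (intro member_le_sum) auto
    also have "\<dots> = nat x"
      using t unfolding monomials_of_degree_def by (metis (mono_tags, lifting) mem_Collect_eq nat_int)
    finally show "Poly_Mapping.lookup t i \<le> nat x" .
  qed
  thus "finite (?f ` monomials_of_degree d A x)"
    by (rule finite_subset) (intro finite_set_of_finite_funs A finite_atMost)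
  show "inj_on ?f (monomials_of_degree d A x)"
  proof (rule inj_onI, rule poly_mapping_eqI)
    fix t s i assume t: "t \<in> monomials_of_degree d A x" and s: "s \<in> monomials_of_degree d A x"
      and eq: "?f t = ?f s"
    show "Poly_Mapping.lookup t i = Poly_Mapping.lookup s i"
    proof (cases "i \<in> A")
      case True
      thus ?thesis using fun_cong[OF eq, of i] by simp
    next
      case False
      hence "i \<notin> Poly_Mapping.keys t" "i \<notin> Poly_Mapping.keys s"
        using t s by (auto simp: monomials_of_degree_def)
      thus ?thesis by (simp add: in_keys_iff)
    qed
  qed
qed

text \<open>A monomial containing the variable \<open>i\<close> can be divided by it, which lowers
  the degree by \<open>d i\<close>; the others involve only variables in \<open>A\<close>.\<close>

lemma card_monomials_insert:
  assumes A: "finite A" "i \<notin> A" and pos: "\<And>j. j \<in> insert i A \<Longrightarrow> 0 < d j"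
  shows "card (monomials_of_degree d (insert i A) x) =
    card (monomials_of_degree d (insert i A) (x - int (d i))) + card (monomials_of_degree d A x)"
proof -
  let ?M = "monomials_of_degree d (insert i A)"
  let ?e = "Poly_Mapping.single i (1::nat)"
  have inj: "inj_on (\<lambda>t. t + ?e) (?M (x - int (d i)))" by (simp add: inj_on_def)
  have fin: "finite (?M y)" for y using finite_monomials_of_degree[of "insert i A" d] assms by auto
  have finA: "finite (monomials_of_degree d A x)"
    using finite_monomials_of_degree[of A d] assms by auto
  have sum_add: "(\<Sum>j\<in>A. Poly_Mapping.lookup (t + ?e) j * d j) = (\<Sum>j\<in>A. Poly_Mapping.lookup t j * d j)" for t
    using A(2) by (intro sum.cong) (auto simp: lookup_add lookup_single when_def)
  have deg: "int (\<Sum>j\<in>insert i A. Poly_Mapping.lookup (t + ?e) j * d j)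
     = int (\<Sum>j\<in>insert i A. Poly_Mapping.lookup t j * d j) + int (d i)" for t
    using A sum_add[of t] by (simp add: lookup_add distrib_right)
  have keys: "Poly_Mapping.keys (t + ?e) \<subseteq> insert i A \<longleftrightarrow> Poly_Mapping.keys t \<subseteq> insert i A" for t
    by (auto simp: in_keys_iff lookup_add lookup_single subset_iff when_def split: if_splits)
  have M: "t + ?e \<in> ?M x \<longleftrightarrow> t \<in> ?M (x - int (d i))" for t
    unfolding monomials_of_degree_def mem_Collect_eq deg keys by auto
  have "?M x = (\<lambda>t. t + ?e) ` ?M (x - int (d i)) \<union> monomials_of_degree d A x"
  proof (intro equalityI subsetI)
    fix t assume t: "t \<in> ?M x"
    show "t \<in> (\<lambda>t. t + ?e) ` ?M (x - int (d i)) \<union> monomials_of_degree d A x"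
    proof (cases "Poly_Mapping.lookup t i = 0")
      case True
      thus ?thesis using t A by (auto simp: monomials_of_degree_def in_keys_iff)
    next
      case False
      define s where "s = t - ?e"
      have t_eq: "t = s + ?e"
        using False
        by (intro poly_mapping_eqI) (auto simp: s_def lookup_add lookup_minus lookup_single when_def)
      hence "s \<in> ?M (x - int (d i))"
        using t M by simp
      thus ?thesis using t_eq by blast
    qed
  next
    fix t assume "t \<in> (\<lambda>t. t + ?e) ` ?M (x - int (d i)) \<union> monomials_of_degree d A x"
    thus "t \<in> ?M x"
    proof
      assume "t \<in> (\<lambda>t. t + ?e) ` ?M (x - int (d i))"
      then obtain s where s: "t = s + ?e" "s \<in> ?M (x - int (d i))" by blast
      thus ?thesis using M by simp
    next
      assume t: "t \<in> monomials_of_degree d A x"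
      hence "Poly_Mapping.lookup t i = 0"
        using A(2) by (auto simp: monomials_of_degree_def in_keys_iff)
      thus ?thesis using t A by (auto simp: monomials_of_degree_def)
    qed
  qed
  moreover have "(\<lambda>t. t + ?e) ` ?M (x - int (d i)) \<inter> monomials_of_degree d A x = {}"
  proof (intro equals0I, elim IntE imageE)
    fix t s assume "t \<in> monomials_of_degree d A x" and t: "t = s + ?e"
    hence "Poly_Mapping.lookup t i = 0"
      using A(2) by (auto simp: monomials_of_degree_def in_keys_iff)
    thus False using t by (simp add: lookup_add)
  qed
  ultimately show ?thesis
    using fin finA card_image[OF inj] by (simp add: card_Un_disjoint)
qed

lemma alt_shift_card_monomials:
  assumes "finite A" "\<And>i. i \<in> A \<Longrightarrow> 0 < d i"
  shows "alt_shift d A (\<lambda>y. int (card (monomials_of_degree d A y))) x = (if x = 0 then 1 else 0)"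
  using assms
proof (induction A)
  case empty
  have "monomials_of_degree d {} x = (if x = 0 then {0} else {})"
    by (auto simp: monomials_of_degree_def)
  thus ?case by simp
next
  case (insert i A)
  have "int (card (monomials_of_degree d (insert i A) y))
     - int (card (monomials_of_degree d (insert i A) (y - int (d i))))
     = int (card (monomials_of_degree d A y))" for y
    using card_monomials_insert[of A i d y] insert by simp
  thus ?case using insert by (simp add: alt_shift_insert)
qed

section \<open>Numerical semigroups\<close>

locale numerical_semigroup =
  fixes m :: nat and d :: "nat \<Rightarrow> nat"
  assumes pos: "i \<in> {1..m} \<Longrightarrow> 0 < d i"
    and gcd1: "Gcd (d ` {1..m}) = 1"
begin

abbreviation "S \<equiv> semigroup_of m d"
abbreviation "F \<equiv> frobenius m d"

lemma mem_semigroup: "x \<in> S \<longleftrightarrow> (\<exists>a. x = int (\<Sum>i=1..m. a i * d i))"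
  unfolding semigroup_of_def by simp

lemma zero_in: "0 \<in> S"
  unfolding semigroup_of_def by (auto intro!: exI[of _ "\<lambda>_. 0"])

lemma generator_in: "int (d i) \<in> S" if "i \<in> {1..m}"
  unfolding semigroup_of_def mem_Collect_eq
  by (rule exI[of _ "\<lambda>j. if j = i then 1 else 0"])
    (use that in \<open>auto simp: if_distrib[where f = "\<lambda>x. x * _"] cong: if_cong\<close>)

lemma add_in: "x + y \<in> S" if "x \<in> S" "y \<in> S"
proof -
  from that(1) obtain a where "x = int (\<Sum>i=1..m. a i * d i)" unfolding mem_semigroup ..
  moreover from that(2) obtain b where "y = int (\<Sum>i=1..m. b i * d i)" unfolding mem_semigroup ..
  ultimately have "x + y = int (\<Sum>i=1..m. (a i + b i) * d i)"
    by (simp add: sum.distrib distrib_right)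
  thus ?thesis unfolding mem_semigroup by (rule exI[of _ "\<lambda>i. a i + b i"])
qed

lemma nonneg: "0 \<le> x" if "x \<in> S"
  using that unfolding mem_semigroup by (elim exE) (simp only: of_nat_0_le_iff)

lemma mult_in: "int k * x \<in> S" if "x \<in> S"
  by (induction k) (auto simp: zero_in distrib_right intro: add_in that)

text \<open>Differences of elements of \<open>S\<close> form a subgroup of the integers, and
  Bezout's identity puts the gcd of any finite set of generators into it.\<close>

lemma gcd_is_difference: "\<exists>a\<in>S. \<exists>b\<in>S. a = b + int g" if "g = Gcd (d ` {1..m})"
proof -
  define G where "G = {a - b | a b. a \<in> S \<and> b \<in> S}"
  have G0: "0 \<in> G" unfolding G_def using zero_in by force
  have Gdiff: "x - y \<in> G" if "x \<in> G" "y \<in> G" for x y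
  proof -
    obtain a b a' b' where *: "x = a - b" "y = a' - b'" "a \<in> S" "b \<in> S" "a' \<in> S" "b' \<in> S"
      using \<open>x \<in> G\<close> \<open>y \<in> G\<close> unfolding G_def by blast
    hence "x - y = (a + b') - (b + a')" by simp
    thus ?thesis using * add_in unfolding G_def by blast
  qed
  have Gadd: "x + y \<in> G" if "x \<in> G" "y \<in> G" for x y
    using Gdiff[OF that(1) Gdiff[OF G0 that(2)]] by simp
  have Gmult: "x * k \<in> G" if "x \<in> G" for x k
  proof (induction k rule: int_induct[of _ 0])
    case base thus ?case using G0 by simp
  next
    case (step1 k) thus ?case using Gadd[OF _ that] by (simp add: distrib_left)
  next
    case (step2 k) thus ?case using Gdiff[OF _ that] by (simp add: right_diff_distrib)
  qed
  have "int g = Gcd (int ` d ` {1..m})"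
    unfolding that by simp
  moreover have "Gcd (int ` A) \<in> G" if "finite A" "A \<subseteq> d ` {1..m}" for A
    using that
  proof (induction A)
    case (insert x A)
    have "int x \<in> G"
      using insert.prems generator_in zero_in unfolding G_def by force
    moreover have "Gcd (int ` A) \<in> G" using insert by simp
    moreover obtain u v where "u * int x + v * Gcd (int ` A) = gcd (int x) (Gcd (int ` A))"
      using bezout_int by blast
    ultimately show ?case using Gadd Gmult by (metis Gcd_insert image_insert mult.commute)
  qed (simp add: G0)
  ultimately have "int g \<in> G" by simp
  thus ?thesis unfolding G_def by force
qed

lemma conductor_exists: "\<exists>c. \<forall>x\<ge>c. x \<in> S"
proof -
  obtain a b where ab: "a \<in> S" "b \<in> S" "a = b + 1"
    using gcd_is_difference[OF refl] gcd1 by auto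
  show ?thesis
  proof (cases "b = 0")
    case True
    hence "x \<in> S" if "x \<ge> 0" for x
      using mult_in[OF ab(1), of "nat x"] ab that by simp
    thus ?thesis by blast
  next
    case False
    hence b: "b > 0" using nonneg[OF ab(2)] by simp
    \<comment> \<open>With \<open>b \<le> q\<close> and \<open>r < b\<close>, the remainder is
      absorbed by using \<open>a = b + 1\<close> exactly \<open>r\<close> times:
      \<open>q * b + r = (q - r) * b + r * a\<close>.\<close>
    have "x \<in> S" if x: "x \<ge> b * b" for x
    proof -
      define q r where "q = x div b" and "r = x mod b"
      have r: "0 \<le> r" "r < b" using b by (auto simp: r_def)
      have "b \<le> q" using x b unfolding q_def by (metis div_mult_self1_is_m less_irrefl zdiv_mono1 nonzero_mult_div_cancel_left)
      have "x = q * b + r" by (simp add: q_def r_def)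
      also have "\<dots> = int (nat (q - r)) * b + int (nat r) * a"
        using r \<open>b \<le> q\<close> by (simp add: ab(3) algebra_simps)
      also have "\<dots> \<in> S" by (intro add_in mult_in ab)
      finally show ?thesis .
    qed
    thus ?thesis by blast
  qed
qed

lemma frobenius_greatest: "F \<notin> S" and above_frobenius: "\<And>x. x > F \<Longrightarrow> x \<in> S"
proof -
  obtain c where c: "\<And>x. x \<ge> c \<Longrightarrow> x \<in> S" using conductor_exists by blast
  have "-1 \<notin> S" using nonneg[of "-1"] by auto
  \<comment> \<open>The least number of steps down from \<open>c - 1\<close> that reaches a gap. It
    exists because negative integers are gaps.\<close>
  define k where "k = (LEAST k. c - 1 - int k \<notin> S)"
  have "c - 1 - int (nat c) \<notin> S" 
    using nonneg[of "c - 1 - int (nat c)"] by linarith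
  hence k: "c - 1 - int k \<notin> S" unfolding k_def by (rule LeastI)
  have above: "x \<in> S" if "x > c - 1 - int k" for x
  proof (cases "x \<ge> c")
    case False
    hence "nat (c - 1 - x) < k" using that by auto
    hence "c - 1 - int (nat (c - 1 - x)) \<in> S" unfolding k_def using not_less_Least by blast
    thus ?thesis using False by simp
  qed (rule c)
  have F: "F = c - 1 - int k"
    unfolding frobenius_def using k above by (intro Greatest_equality) force+
  show "F \<notin> S" using F k by simp
  show "x \<in> S" if "x > F" for x using above that F by simp
qed

text \<open>If \<open>x\<close> and \<open>F - x\<close> were both in \<open>S\<close>, so would be
  their sum \<open>F\<close>. The case of neither is the definition of
  \<open>\<Delta>H\<close>.\<close>

lemma mem_partition_reflect:
  "of_bool (x \<in> S) + of_bool (F - x \<in> S) + of_bool (x \<in> \<Delta>H m d) = (1 :: int)"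
  using add_in[of x "F - x"] frobenius_greatest by (auto simp: \<Delta>H_def)

lemma \<Delta>H_reflect: "F - x \<in> \<Delta>H m d \<longleftrightarrow> x \<in> \<Delta>H m d"
  by (auto simp: \<Delta>H_def)

text \<open>A negative \<open>x\<close> would make \<open>F - x\<close> larger than
  \<open>F\<close>, hence an element of \<open>S\<close>.\<close>

lemma \<Delta>H_bounds: "0 \<le> x" "x \<le> F" if "x \<in> \<Delta>H m d"
  using that above_frobenius[of x] above_frobenius[of "F - x"] unfolding \<Delta>H_def by force+

lemma finite_\<Delta>H: "finite (\<Delta>H m d)"
  by (rule finite_subset[of _ "{0..F}"]) (auto dest: \<Delta>H_bounds)

lemma pseudo_frobenius_eq:
  assumes "almost_symmetric m d"
  shows "pseudo_frobenius m d = insert F (\<Delta>H m d)" "F \<notin> \<Delta>H m d"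
proof -
  have "F \<in> pseudo_frobenius m d"
  proof -
    have "F + s \<in> S" if "s \<in> S - {0}" for s
      using above_frobenius[of "F + s"] nonneg[of s] that by force
    thus ?thesis using frobenius_greatest by (simp add: pseudo_frobenius_def)
  qed
  thus "pseudo_frobenius m d = insert F (\<Delta>H m d)" "F \<notin> \<Delta>H m d"
    using assms unfolding almost_symmetric_def by auto
qed

end

section \<open>Operations on polynomials\<close>

abbreviation var :: "nat \<Rightarrow> ('k::field_char_0) mpol" where
  "var i \<equiv> Poly_Mapping.single (Poly_Mapping.single i (Suc 0)) 1"

lemma sum_single_lookup:
  fixes p :: "'a \<Rightarrow>\<^sub>0 'b::comm_monoid_add"
  shows "(\<Sum>t\<in>Poly_Mapping.keys p. Poly_Mapping.single t (Poly_Mapping.lookup p t)) = p"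
proof (rule poly_mapping_eqI)
  fix s
  have "(\<Sum>t\<in>Poly_Mapping.keys p. Poly_Mapping.lookup (Poly_Mapping.single t (Poly_Mapping.lookup p t)) s)
      = (\<Sum>t\<in>Poly_Mapping.keys p. if t = s then Poly_Mapping.lookup p t else 0)"
    by (intro sum.cong) (auto simp: lookup_single when_def)
  thus "Poly_Mapping.lookup (\<Sum>t\<in>Poly_Mapping.keys p. Poly_Mapping.single t (Poly_Mapping.lookup p t)) s
      = Poly_Mapping.lookup p s"
    by (auto simp: lookup_sum in_keys_iff)
qed

lemma mult_eq_sum_single:
  fixes p q :: "('a::monoid_add) \<Rightarrow>\<^sub>0 ('b::semiring_0)"
  shows "p * q = (\<Sum>t\<in>Poly_Mapping.keys p. \<Sum>s\<in>Poly_Mapping.keys q.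
     Poly_Mapping.single (t + s) (Poly_Mapping.lookup p t * Poly_Mapping.lookup q s))"
  by (subst (1) sum_single_lookup[of p, symmetric], subst (1) sum_single_lookup[of q, symmetric])
     (simp add: sum_product mult_single)

lemma lookup_single_mult:
  fixes p :: "('a::cancel_comm_monoid_add) \<Rightarrow>\<^sub>0 ('b::comm_semiring_0)"
  shows "Poly_Mapping.lookup (Poly_Mapping.single s c * p) (s + t) = c * Poly_Mapping.lookup p t"
proof -
  have "Poly_Mapping.single s c * p
      = (\<Sum>u\<in>Poly_Mapping.keys p. Poly_Mapping.single (s + u) (c * Poly_Mapping.lookup p u))"
    by (subst (1) sum_single_lookup[of p, symmetric]) (simp add: sum_distrib_left mult_single)
  hence "Poly_Mapping.lookup (Poly_Mapping.single s c * p) (s + t)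
      = (\<Sum>u\<in>Poly_Mapping.keys p. if u = t then c * Poly_Mapping.lookup p u else 0)"
    by (auto simp: lookup_sum lookup_single when_def intro!: sum.cong)
  thus ?thesis by (auto simp: in_keys_iff)
qed

lemma lookup_var_mult:
  "Poly_Mapping.lookup (var i * p) t =
     (if Poly_Mapping.lookup t i = 0 then 0
      else Poly_Mapping.lookup p (t - Poly_Mapping.single i (Suc 0)))"
proof (cases "Poly_Mapping.lookup t i = 0")
  case True
  have "t \<notin> Poly_Mapping.keys (var i * p)"
  proof
    assume "t \<in> Poly_Mapping.keys (var i * p)"
    then obtain s where "t = Poly_Mapping.single i (Suc 0) + s"
      using keys_mult[of "var i" p] by (auto split: if_splits)
    thus False using True by (simp add: lookup_add)
  qed
  thus ?thesis using True by (simp add: in_keys_iff)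
next
  case False
  hence "t = Poly_Mapping.single i (Suc 0) + (t - Poly_Mapping.single i (Suc 0))"
    by (intro poly_mapping_eqI) (auto simp: lookup_add lookup_minus lookup_single when_def)
  thus ?thesis using False lookup_single_mult[of "Poly_Mapping.single i (Suc 0)" 1 p]
    by (metis mult_1)
qed

lemma lookup_mult_zero:
  fixes p q :: "('k::field_char_0) mpol"
  shows "Poly_Mapping.lookup (p * q) 0 = Poly_Mapping.lookup p 0 * Poly_Mapping.lookup q 0"
proof -
  have z: "t + s = 0 \<longleftrightarrow> t = 0 \<and> s = 0" for t s :: "nat \<Rightarrow>\<^sub>0 nat"
    by (auto simp: poly_mapping_eq_iff fun_eq_iff lookup_add)
  have "Poly_Mapping.lookup (p * q) 0 =
     (\<Sum>t\<in>Poly_Mapping.keys p. \<Sum>s\<in>Poly_Mapping.keys q.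
        if t = 0 then (if s = 0 then Poly_Mapping.lookup p 0 * Poly_Mapping.lookup q 0 else 0) else 0)"
    unfolding mult_eq_sum_single lookup_sum
    by (intro sum.cong refl) (auto simp: lookup_single when_def z)
  also have "\<dots> = (\<Sum>t\<in>Poly_Mapping.keys p. if t = 0 then
      (\<Sum>s\<in>Poly_Mapping.keys q. if s = 0 then Poly_Mapping.lookup p 0 * Poly_Mapping.lookup q 0 else 0) else 0)"
    by (intro sum.cong refl) auto
  also have "\<dots> = Poly_Mapping.lookup p 0 * Poly_Mapping.lookup q 0"
    by (auto simp: in_keys_iff)
  finally show ?thesis .
qed

section \<open>Selecting monomials and dividing by variables\<close>

lift_definition restrict_keys :: "('a \<Rightarrow> bool) \<Rightarrow> ('a \<Rightarrow>\<^sub>0 'b::zero) \<Rightarrow> ('a \<Rightarrow>\<^sub>0 'b)" is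
  "\<lambda>P f t. if P t then f t else 0"
  by (rule finite_subset) auto

lemma lookup_restrict_keys:
  "Poly_Mapping.lookup (restrict_keys P p) t = (if P t then Poly_Mapping.lookup p t else 0)"
  by transfer rule

lemma keys_restrict_keys: "Poly_Mapping.keys (restrict_keys P p) = {t \<in> Poly_Mapping.keys p. P t}"
  by (auto simp: in_keys_iff lookup_restrict_keys split: if_splits)

lemma restrict_keys_zero [simp]: "restrict_keys P 0 = 0"
  by (rule poly_mapping_eqI) (simp add: lookup_restrict_keys)

lemma restrict_keys_add:
  "restrict_keys P (p + q :: 'a \<Rightarrow>\<^sub>0 'b::monoid_add) = restrict_keys P p + restrict_keys P q"
  by (rule poly_mapping_eqI) (simp add: lookup_restrict_keys lookup_add)

lemma restrict_keys_sum:
  "restrict_keys P (\<Sum>x\<in>A. f x :: 'a \<Rightarrow>\<^sub>0 'b::comm_monoid_add) = (\<Sum>x\<in>A. restrict_keys P (f x))"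
  by (induction A rule: infinite_finite_induct) (auto simp: restrict_keys_add)

lemma restrict_keys_single:
  "restrict_keys P (Poly_Mapping.single t c) = (if P t then Poly_Mapping.single t c else 0)"
  by (rule poly_mapping_eqI) (auto simp: lookup_restrict_keys lookup_single when_def)

lemma restrict_keys_eq_self: "restrict_keys P p = p" if "\<And>t. t \<in> Poly_Mapping.keys p \<Longrightarrow> P t"
  using that by (intro poly_mapping_eqI) (auto simp: lookup_restrict_keys in_keys_iff)

text \<open>Made for homogeneous \<open>q\<close>: \<open>P\<close> and \<open>P'\<close> are then
  degree conditions that differ by the degree of \<open>q\<close>.\<close>

lemma restrict_keys_mult:
  fixes p q :: "('a::monoid_add) \<Rightarrow>\<^sub>0 ('b::semiring_0)"
  assumes "\<And>t s. t \<in> Poly_Mapping.keys q \<Longrightarrow> P' (t + s) \<longleftrightarrow> P s"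
  shows "restrict_keys P' (q * p) = q * restrict_keys P p"
proof -
  have "restrict_keys P' (q * p) = (\<Sum>t\<in>Poly_Mapping.keys q. \<Sum>s\<in>Poly_Mapping.keys p.
     Poly_Mapping.single t (Poly_Mapping.lookup q t) *
     restrict_keys P (Poly_Mapping.single s (Poly_Mapping.lookup p s)))"
    unfolding mult_eq_sum_single restrict_keys_sum
    by (intro sum.cong refl) (auto simp: restrict_keys_single assms mult_single)
  also have "\<dots> = q * restrict_keys P p"
    unfolding sum_product[symmetric] restrict_keys_sum[symmetric] sum_single_lookup ..
  finally show ?thesis .
qed

text \<open>\<open>div_var v p\<close> is \<open>(p(0, \<dots>, 0, X\<^sub>v, X\<^sub>v\<^sub>+\<^sub>1, \<dots>) - p(0, \<dots>, 0, 0, X\<^sub>v\<^sub>+\<^sub>1, \<dots>)) / X\<^sub>v\<close>: it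
  divides those monomials by \<open>X\<^sub>v\<close> whose smallest variable is \<open>X\<^sub>v\<close> and kills the others.\<close>

lift_definition div_var :: "nat \<Rightarrow> ((nat \<Rightarrow>\<^sub>0 nat) \<Rightarrow>\<^sub>0 'b::zero) \<Rightarrow> ((nat \<Rightarrow>\<^sub>0 nat) \<Rightarrow>\<^sub>0 'b)" is
  "\<lambda>v f t. if \<forall>i<v. Poly_Mapping.lookup t i = 0 then f (t + Poly_Mapping.single v (Suc 0)) else 0"
proof -
  fix v and f :: "(nat \<Rightarrow>\<^sub>0 nat) \<Rightarrow> 'b"
  assume "finite {t. f t \<noteq> 0}"
  hence "finite ((\<lambda>t. t + Poly_Mapping.single v (Suc 0)) -` {t. f t \<noteq> 0})"
    by (rule finite_vimageI) (simp add: inj_on_def)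
  thus "finite {t. (if \<forall>i<v. Poly_Mapping.lookup t i = 0 then f (t + Poly_Mapping.single v (Suc 0)) else 0) \<noteq> 0}"
    by (rule rev_finite_subset) auto
qed

lemma lookup_div_var:
  "Poly_Mapping.lookup (div_var v p) t =
    (if \<forall>i<v. Poly_Mapping.lookup t i = 0 then Poly_Mapping.lookup p (t + Poly_Mapping.single v (Suc 0)) else 0)"
  by transfer rule

lemma div_var_zero [simp]: "div_var v 0 = 0"
  by (rule poly_mapping_eqI) (simp add: lookup_div_var)

lemma div_var_add:
  "div_var v (p + q :: (nat \<Rightarrow>\<^sub>0 nat) \<Rightarrow>\<^sub>0 'b::monoid_add) = div_var v p + div_var v q"
  by (rule poly_mapping_eqI) (auto simp: lookup_div_var lookup_add)

lemma div_var_sum: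
  "div_var v (\<Sum>x\<in>A. f x :: (nat \<Rightarrow>\<^sub>0 nat) \<Rightarrow>\<^sub>0 'b::comm_monoid_add) = (\<Sum>x\<in>A. div_var v (f x))"
  by (induction A rule: infinite_finite_induct) (auto simp: div_var_add)

lemma div_var_sign:
  "div_var v ((-1) ^ k * p) = (-1) ^ k * div_var v (p :: ('k::field_char_0) mpol)"
proof -
  have "div_var v (- p) = - div_var v p" for p :: "'k mpol"
    by (rule poly_mapping_eqI) (auto simp: lookup_div_var)
  thus ?thesis by (induction k) auto
qed

lemma exponent_add_diff: "Poly_Mapping.lookup t i \<noteq> 0 \<Longrightarrow>
   t - Poly_Mapping.single i (Suc 0) + Poly_Mapping.single i (Suc 0) = (t :: nat \<Rightarrow>\<^sub>0 nat)"
  by (intro poly_mapping_eqI) (auto simp: lookup_add lookup_minus lookup_single when_def)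

lemma var_mult_div_var:
  "var v * div_var v p =
    restrict_keys (\<lambda>t. (\<forall>i<v. Poly_Mapping.lookup t i = 0) \<and> Poly_Mapping.lookup t v \<noteq> 0) p"
  by (rule poly_mapping_eqI)
    (auto simp: lookup_var_mult lookup_div_var lookup_restrict_keys exponent_add_diff
       lookup_minus lookup_single_not_eq)

text \<open>For \<open>i < v\<close> every monomial of the product contains a variable below
  \<open>v\<close> and is killed; for \<open>i > v\<close> the factor does not influence which
  variable is smallest.\<close>

lemma div_var_var_mult:
  "div_var v (var i * p) =
    (if i < v then 0 else if i = v then restrict_keys (\<lambda>t. \<forall>i<v. Poly_Mapping.lookup t i = 0) p
     else var i * div_var v p)"
proof (rule poly_mapping_eqI)
  fix t :: "nat \<Rightarrow>\<^sub>0 nat"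
  have "t + Poly_Mapping.single v (Suc 0) - Poly_Mapping.single i (Suc 0)
      = t - Poly_Mapping.single i (Suc 0) + Poly_Mapping.single v (Suc 0)"
    if "v < i"
    using that
    by (intro poly_mapping_eqI) (auto simp: lookup_add lookup_minus lookup_single when_def)
  thus "Poly_Mapping.lookup (div_var v (var i * p)) t = Poly_Mapping.lookup
     (if i < v then 0 else if i = v then restrict_keys (\<lambda>t. \<forall>i<v. Poly_Mapping.lookup t i = 0) p
     else var i * div_var v p) t"
    by (auto simp: lookup_var_mult lookup_div_var lookup_restrict_keys lookup_add
         lookup_minus lookup_single_not_eq)
qed

lemma poly_ring_zero [simp]: "0 \<in> poly_ring m"
  by (simp add: poly_ring_def)

lemma poly_ring_add: "p \<in> poly_ring m \<Longrightarrow> q \<in> poly_ring m \<Longrightarrow> p + q \<in> poly_ring m"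
  using keys_add[of p q] by (auto simp: poly_ring_def)

lemma poly_ring_uminus: "p \<in> poly_ring m \<Longrightarrow> - p \<in> poly_ring m"
  by (auto simp: poly_ring_def in_keys_iff)

lemma poly_ring_sum: "(\<And>x. x \<in> A \<Longrightarrow> f x \<in> poly_ring m) \<Longrightarrow> sum f A \<in> poly_ring m"
  by (induction A rule: infinite_finite_induct) (auto simp: poly_ring_add)

lemma poly_ring_mult: "p \<in> poly_ring m \<Longrightarrow> q \<in> poly_ring m \<Longrightarrow> p * q \<in> poly_ring m"
  unfolding poly_ring_def mem_Collect_eq
proof (intro ballI)
  fix t assume p: "\<forall>t\<in>Poly_Mapping.keys p. Poly_Mapping.keys t \<subseteq> {1..m}"
    and q: "\<forall>t\<in>Poly_Mapping.keys q. Poly_Mapping.keys t \<subseteq> {1..m}"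
    and "t \<in> Poly_Mapping.keys (p * q)"
  then obtain a b where "t = a + b" "a \<in> Poly_Mapping.keys p" "b \<in> Poly_Mapping.keys q"
    using keys_mult[of p q] by blast
  thus "Poly_Mapping.keys t \<subseteq> {1..m}"
    using p q keys_add[of a b] by blast
qed

lemma poly_ring_single: "Poly_Mapping.keys t \<subseteq> {1..m} \<Longrightarrow> Poly_Mapping.single t c \<in> poly_ring m"
  by (auto simp: poly_ring_def)

lemma poly_ring_sign: "(-1) ^ k \<in> poly_ring m"
proof (induction k)
  case 0
  show ?case using poly_ring_single[of 0 m 1] by simp
next
  case (Suc k)
  thus ?case using poly_ring_uminus by simp
qed

lemma poly_ring_one: "1 \<in> poly_ring m"
  by (simp add: poly_ring_def)

lemma poly_ring_restrict_keys: "p \<in> poly_ring m \<Longrightarrow> restrict_keys P p \<in> poly_ring m"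
  by (auto simp: poly_ring_def keys_restrict_keys)

lemma poly_ring_div_var:
  assumes "p \<in> poly_ring m" shows "div_var v p \<in> poly_ring m"
  unfolding poly_ring_def mem_Collect_eq
proof (intro ballI)
  fix t assume "t \<in> Poly_Mapping.keys (div_var v p)"
  hence "t + Poly_Mapping.single v (Suc 0) \<in> Poly_Mapping.keys p"
    by (auto simp: in_keys_iff lookup_div_var split: if_splits)
  hence "Poly_Mapping.keys (t + Poly_Mapping.single v (Suc 0)) \<subseteq> {1..m}"
    using assms by (auto simp: poly_ring_def)
  moreover have "Poly_Mapping.keys t \<subseteq> Poly_Mapping.keys (t + Poly_Mapping.single v (Suc 0))"
    by (auto simp: in_keys_iff lookup_add)
  ultimately show "Poly_Mapping.keys t \<subseteq> {1..m}" by blast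
qed

text \<open>Monomials are sorted by their smallest variable; those without a variable below
  \<open>w\<close> are left over.\<close>

lemma sum_var_mult_div_var:
  assumes "p \<in> poly_ring m" "1 \<le> w"
  shows "(\<Sum>v=1..<w. var v * div_var v p) + restrict_keys (\<lambda>t. \<forall>i<w. Poly_Mapping.lookup t i = 0) p = p"
  using assms(2)
proof (induction w rule: dec_induct)
  case base
  \<comment> \<open>Variables are numbered from 1, so at \<open>w = 1\<close> the remaining
    condition, on index 0, is void.\<close>
  have "Poly_Mapping.lookup t 0 = 0" if "t \<in> Poly_Mapping.keys p" for t
    using assms(1) that by (auto simp: poly_ring_def in_keys_iff subset_iff)
  thus ?case by (simp add: restrict_keys_eq_self)
next
  case (step w)
  have "restrict_keys (\<lambda>t. \<forall>i<w. Poly_Mapping.lookup t i = 0) p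
     = var w * div_var w p + restrict_keys (\<lambda>t. \<forall>i<Suc w. Poly_Mapping.lookup t i = 0) p"
    unfolding var_mult_div_var
    by (rule poly_mapping_eqI) (auto simp: lookup_restrict_keys lookup_add less_Suc_eq)
  thus ?case using step by (simp add: add.assoc)
qed

section \<open>The Koszul complex\<close>

definition koszul_sign :: "nat \<Rightarrow> nat set \<Rightarrow> ('k::field_char_0) mpol" where
  "koszul_sign i I = (-1) ^ card {j\<in>I. j < i}"

lemma koszul_sign_insert:
  assumes "l \<notin> I"
  shows "koszul_sign i (insert l I) = (if l < i then - koszul_sign i I else koszul_sign i I)"
proof (cases "l < i")
  case True
  hence "{j \<in> insert l I. j < i} = insert l {j\<in>I. j < i}" by auto
  thus ?thesis using True assms by (simp add: koszul_sign_def)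
next
  case False
  hence "{j \<in> insert l I. j < i} = {j\<in>I. j < i}" by auto
  thus ?thesis using False by (simp add: koszul_sign_def)
qed

text \<open>The rule \<open>e_i e_l = - e_l e_i\<close>: only the larger of the two indices sees
  whether the other has been inserted.\<close>

lemma koszul_sign_antisym:
  assumes "i \<noteq> l" "i \<notin> I" "l \<notin> I"
  shows "koszul_sign i I * koszul_sign l (insert i I) = - (koszul_sign l I * koszul_sign i (insert l I))"
  using assms by (cases i l rule: linorder_cases) (auto simp: koszul_sign_insert)

lemma koszul_sign_below: "koszul_sign i I = 1" if "\<And>j. j \<in> I \<Longrightarrow> i \<le> j"
proof -
  have "{j\<in>I. j < i} = {}" using that by force
  thus ?thesis unfolding koszul_sign_def by (metis card.empty power_0)
qed

text \<open>A family \<open>a\<close> stands for the element \<open>\<Sum>\<^sub>I a I \<otimes> e\<^sub>I\<close> of a free module tensored with an exterior algebra.\<close>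

definition koszul_map ::
  "nat \<Rightarrow> (nat set \<Rightarrow> nat \<Rightarrow> ('k::field_char_0) mpol) \<Rightarrow> nat set \<Rightarrow> nat \<Rightarrow> 'k mpol" where
  "koszul_map m a I j = (\<Sum>i\<in>{1..m} - I. koszul_sign i I * (var i * a (insert i I) j))"

lemma koszul_map_diff: "koszul_map m (a - b) = koszul_map m a - koszul_map m b"
  by (intro ext) (simp add: koszul_map_def right_diff_distrib sum_subtractf)

lemma koszul_map_zero [simp]: "koszul_map m 0 = 0"
  by (intro ext) (simp add: koszul_map_def)

text \<open>Removing \<open>i\<close> and \<open>l\<close> in either order gives opposite terms.
  Swapping the pair shows that the sum equals its negative, and 2 is invertible in characteristic
  0.\<close>

lemma koszul_map_koszul_map: "koszul_map m (koszul_map m a) = 0"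
proof (intro ext)
  fix I j
  let ?D = "Sigma ({1..m} - I) (\<lambda>i. {1..m} - insert i I)"
  let ?T = "\<lambda>(i, l). koszul_sign i I * (var i * (koszul_sign l (insert i I) *
                (var l * a (insert l (insert i I)) j)))"
  have "koszul_map m (koszul_map m a) I j = sum ?T ?D"
    unfolding koszul_map_def by (simp add: sum_distrib_left sum.Sigma)
  moreover have "sum ?T ?D = (\<Sum>p\<in>?D. - ?T p)"
  proof (rule sum.reindex_bij_witness[where i = prod.swap and j = prod.swap])
    fix p assume "p \<in> ?D"
    then obtain i l where p: "p = (i, l)" "i \<noteq> l" "i \<notin> I" "l \<notin> I" by auto
    have "?T p = (koszul_sign i I * koszul_sign l (insert i I)) * (var i * var l * a (insert l (insert i I)) j)"
      by (simp add: p mult_ac)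
    also have "\<dots> = - ((koszul_sign l I * koszul_sign i (insert l I)) * (var i * var l * a (insert l (insert i I)) j))"
      using koszul_sign_antisym[OF p(2-4), where ?'a = 'a] by simp
    also have "\<dots> = - ?T (prod.swap p)"
      by (simp add: p mult_ac insert_commute)
    finally show "- ?T (prod.swap p) = ?T p" ..
  qed auto
  ultimately have "koszul_map m (koszul_map m a) I j = - koszul_map m (koszul_map m a) I j"
    by (simp add: sum_negf)
  hence "2 * koszul_map m (koszul_map m a) I j = 0"
    by simp
  thus "koszul_map m (koszul_map m a) I j = 0 I j"
    by simp
qed

text \<open>Values off the \<open>p\<close>-subsets are forced to be 0, so that equality of chains
  is equality of functions.\<close>

definition koszul_chains :: "nat \<Rightarrow> nat \<Rightarrow> nat \<Rightarrow> (nat set \<Rightarrow> nat \<Rightarrow> ('k::field_char_0) mpol) set" where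
  "koszul_chains m p r =
     {a. \<forall>I. if I \<subseteq> {1..m} \<and> card I = p then a I \<in> free_module m r else a I = 0}"

lemma free_module_entry: "v \<in> free_module m r \<Longrightarrow> v j \<in> poly_ring m"
  unfolding free_module_def by (cases "j \<in> {1..r}") auto

lemma free_module_zero [simp]: "0 \<in> free_module m r"
  by (simp add: free_module_def)

lemma free_module_diff: "v \<in> free_module m r \<Longrightarrow> w \<in> free_module m r \<Longrightarrow> v - w \<in> free_module m r"
  using poly_ring_add[of _ m "- _"] poly_ring_uminus by (fastforce simp: free_module_def)

lemma koszul_chains_free: "a \<in> koszul_chains m p r \<Longrightarrow> a I \<in> free_module m r"
  unfolding koszul_chains_def by (auto dest!: spec[of _ I] split: if_splits)

lemma koszul_chains_entry: "a \<in> koszul_chains m p r \<Longrightarrow> a I j \<in> poly_ring m"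
  using koszul_chains_free free_module_entry by blast

lemma koszul_chains_outside: "a \<in> koszul_chains m p r \<Longrightarrow> \<not> (I \<subseteq> {1..m} \<and> card I = p) \<Longrightarrow> a I = 0"
  unfolding koszul_chains_def by (auto dest!: spec[of _ I])

lemma koszul_chainsI:
  assumes "\<And>I j. I \<subseteq> {1..m} \<Longrightarrow> card I = p \<Longrightarrow> j \<in> {1..r} \<Longrightarrow> a I j \<in> poly_ring m"
    and "\<And>I j. \<not> (I \<subseteq> {1..m} \<and> card I = p \<and> j \<in> {1..r}) \<Longrightarrow> a I j = 0"
  shows "a \<in> koszul_chains m p r"
  unfolding koszul_chains_def mem_Collect_eq
proof (intro allI)
  fix I
  show "if I \<subseteq> {1..m} \<and> card I = p then a I \<in> free_module m r else a I = 0"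
  proof (cases "I \<subseteq> {1..m} \<and> card I = p")
    case True
    thus ?thesis using assms[of I] unfolding free_module_def by auto
  next
    case False
    hence "a I j = 0" for j using assms(2)[of I j] by blast
    hence "a I = 0" by (intro ext) simp
    thus ?thesis by (simp add: False)
  qed
qed

lemma koszul_chains_eq_0:
  assumes "a \<in> koszul_chains m p r" "\<not> (I \<subseteq> {1..m} \<and> card I = p \<and> j \<in> {1..r})"
  shows "a I j = 0"
proof (cases "I \<subseteq> {1..m} \<and> card I = p")
  case True
  thus ?thesis using koszul_chains_free[OF assms(1), of I] assms(2) by (auto simp: free_module_def)
qed (use koszul_chains_outside[OF assms(1)] in simp)

lemma koszul_chains_diff:
  "a \<in> koszul_chains m p r \<Longrightarrow> b \<in> koszul_chains m p r \<Longrightarrow> a - b \<in> koszul_chains m p r"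
  unfolding koszul_chains_def by (auto simp: free_module_diff)

lemma koszul_map_chains:
  assumes a: "a \<in> koszul_chains m (Suc p) r"
  shows "koszul_map m a \<in> koszul_chains m p r"
proof (rule koszul_chainsI)
  show "koszul_map m a I j \<in> poly_ring m" for I j
    unfolding koszul_map_def koszul_sign_def
    by (intro poly_ring_sum poly_ring_mult poly_ring_sign poly_ring_single koszul_chains_entry[OF a]) auto
next
  fix I :: "nat set" and j assume I: "\<not> (I \<subseteq> {1..m} \<and> card I = p \<and> j \<in> {1..r})"
  have "a (insert i I) j = 0" if "i \<in> {1..m} - I" for i
  proof (rule koszul_chains_eq_0[OF a], rule notI)
    assume *: "insert i I \<subseteq> {1..m} \<and> card (insert i I) = Suc p \<and> j \<in> {1..r}"
    hence "finite I" using finite_subset by auto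
    thus False using * I that by auto
  qed
  thus "koszul_map m a I j = 0" unfolding koszul_map_def by simp
qed

lemma koszul_map_chains_0:
  assumes b: "b \<in> koszul_chains m 0 r"
  shows "koszul_map m b = 0"
proof (intro ext)
  fix I j
  have "b (insert i I) j = 0" if "i \<in> {1..m}" for i
  proof (rule koszul_chains_eq_0[OF b], rule notI)
    assume "insert i I \<subseteq> {1..m} \<and> card (insert i I) = 0 \<and> j \<in> {1..r}"
    thus False using finite_subset[of "insert i I" "{1..m}"] by simp
  qed
  thus "koszul_map m b I j = 0 I j" by (simp add: koszul_map_def)
qed

text \<open>Contracting homotopy: on the part of multidegree \<open>u\<close>, where the Koszul complex is the chain complex of the
  full simplex on the support of \<open>u\<close>, it is the cone with apex the smallest vertex.\<close>

definition koszul_homotopy ::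
  "nat \<Rightarrow> (nat set \<Rightarrow> nat \<Rightarrow> ('k::field_char_0) mpol) \<Rightarrow> nat set \<Rightarrow> nat \<Rightarrow> 'k mpol" where
  "koszul_homotopy m a I j =
     (if I \<subseteq> {1..m} \<and> I \<noteq> {} then div_var (Min I) (a (I - {Min I}) j) else 0)"

lemma koszul_homotopy_chains:
  assumes a: "a \<in> koszul_chains m p r"
  shows "koszul_homotopy m a \<in> koszul_chains m (Suc p) r"
proof (rule koszul_chainsI)
  show "koszul_homotopy m a I j \<in> poly_ring m" for I j
    using poly_ring_div_var[OF koszul_chains_entry[OF a]]
    by (cases "I \<subseteq> {1..m} \<and> I \<noteq> {}") (simp_all only: koszul_homotopy_def if_True if_False simp_thms poly_ring_zero)
next
  fix I :: "nat set" and j assume I: "\<not> (I \<subseteq> {1..m} \<and> card I = Suc p \<and> j \<in> {1..r})"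
  show "koszul_homotopy m a I j = 0"
  proof (cases "I \<subseteq> {1..m} \<and> I \<noteq> {}")
    case True
    hence "finite I" using finite_subset by auto
    hence "card (I - {Min I}) = card I - 1" "card I > 0"
      using True by (simp_all add: card_gt_0_iff)
    hence "a (I - {Min I}) j = 0"
      using I True by (intro koszul_chains_eq_0[OF a]) auto
    thus ?thesis by (simp add: koszul_homotopy_def)
  next
    case False
    thus ?thesis unfolding koszul_homotopy_def by (rule if_not_P)
  qed
qed

text \<open>Indices \<open>i\<close> below \<open>Min I\<close> restore the monomials of
  \<open>a I\<close> with a variable below \<open>Min I\<close>; the cycle condition makes the
  larger \<open>i\<close> restore the rest. For \<open>I = {}\<close> there are no larger
  \<open>i\<close>, and exactly the constant term is missed.\<close>

lemma koszul_exact: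
  assumes a: "a \<in> koszul_chains m p r" and cycle: "koszul_map m a = 0"
    and const: "\<And>j. Poly_Mapping.lookup (a {} j) 0 = 0"
  shows "koszul_map m (koszul_homotopy m a) = a"
proof (intro ext)
  fix I j
  show "koszul_map m (koszul_homotopy m a) I j = a I j"
  proof (cases "I \<subseteq> {1..m}")
    case False
    hence "koszul_map m (koszul_homotopy m a) I j = 0"
      by (auto simp: koszul_map_def koszul_homotopy_def)
    thus ?thesis using koszul_chains_outside[OF a] False by auto
  next
    case I: True
    hence fin: "finite I" using finite_subset by auto
    \<comment> \<open>For \<open>I = {}\<close> all variables count as lying below
      \<open>w\<close>.\<close>
    define w where "w = (if I = {} then Suc m else Min I)"
    define low where "low = restrict_keys (\<lambda>t. \<forall>i<w. Poly_Mapping.lookup t i = 0) (a I j)"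
    define R where "R = {i \<in> {1..m} - I. i > w}"
    have w_le: "w \<le> i" if "i \<in> I" for i using that fin by (auto simp: w_def)
    have w1: "1 \<le> w" "w \<le> Suc m"
    proof -
      have "Min I \<in> {1..m}" if "I \<noteq> {}" using I fin that Min_in by blast
      thus "1 \<le> w" "w \<le> Suc m" unfolding w_def by (cases "I = {}"; force)+
    qed
    have wI: "w \<in> I" if "I \<noteq> {}" using that fin by (simp add: w_def)
    have split: "{1..m} - I = {1..<w} \<union> R"
    proof (rule set_eqI)
      fix i
      show "i \<in> {1..m} - I \<longleftrightarrow> i \<in> {1..<w} \<union> R"
      proof (cases "i = w")
        case True
        thus ?thesis using wI by (cases "I = {}") (auto simp: w_def R_def)
      next
        case False
        moreover have "i \<le> m" if "i < w" using that w1 by simp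
        moreover have "i \<notin> I" if "i < w" using that w_le[of i] by auto
        ultimately show ?thesis using w1 by (auto simp: R_def)
      qed
    qed
    have "koszul_map m (koszul_homotopy m a) I j =
        (\<Sum>i\<in>{1..<w}. koszul_sign i I * (var i * koszul_homotopy m a (insert i I) j))
      + (\<Sum>i\<in>R. koszul_sign i I * (var i * koszul_homotopy m a (insert i I) j))"
      unfolding koszul_map_def split
      by (rule sum.union_disjoint) (auto simp: R_def)
    also have "(\<Sum>i\<in>{1..<w}. koszul_sign i I * (var i * koszul_homotopy m a (insert i I) j))
       = (\<Sum>i=1..<w. var i * div_var i (a I j))"
    proof (rule sum.cong)
      fix i assume i: "i \<in> {1..<w}"
      have "i \<in> {1..m}" "i \<notin> I" using i w1 w_le by force+
      moreover have "Min (insert i I) = i"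
        using i w_le fin by (intro Min_eqI) force+
      moreover have "koszul_sign i I = (1 :: 'a mpol)"
        using i w_le by (intro koszul_sign_below) force
      ultimately show "koszul_sign i I * (var i * koszul_homotopy m a (insert i I) j)
        = var i * div_var i (a I j)"
        using I by (simp add: koszul_homotopy_def)
    qed simp
    also have "\<dots> = a I j - low"
      using sum_var_mult_div_var[OF koszul_chains_entry[OF a] w1(1), of I j]
      by (simp add: low_def algebra_simps)
    also have "(\<Sum>i\<in>R. koszul_sign i I * (var i * koszul_homotopy m a (insert i I) j)) = low"
    proof (cases "I = {}")
      case True
      have "low = 0"
      proof (rule poly_mapping_eqI)
        fix t
        have "t = 0" if "\<forall>i<Suc m. Poly_Mapping.lookup t i = 0" "t \<in> Poly_Mapping.keys (a I j)"
        proof (rule poly_mapping_eqI)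
          fix i
          have "Poly_Mapping.keys t \<subseteq> {1..m}"
            using that(2) koszul_chains_entry[OF a, of I j] by (auto simp: poly_ring_def)
          thus "Poly_Mapping.lookup t i = Poly_Mapping.lookup 0 i"
            using that(1) by (cases "i \<le> m") (auto simp: in_keys_iff subset_iff)
        qed
        thus "Poly_Mapping.lookup low t = Poly_Mapping.lookup 0 t"
          using const[of j] True
          by (auto simp: low_def w_def lookup_restrict_keys in_keys_iff)
      qed
      moreover have "R = {}" using True by (auto simp: w_def R_def)
      ultimately show ?thesis by simp
    next
      case False
      define J where "J = I - {w}"
      have J: "I = insert w J" "w \<notin> J" using wI[OF False] by (auto simp: J_def)
      have wm: "w \<in> {1..m}" using wI[OF False] I by blast
      let ?t = "\<lambda>i. div_var w (koszul_sign i J * (var i * a (insert i J) j))"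
      have t_eq: "?t i = koszul_sign i J * div_var w (var i * a (insert i J) j)" for i
        by (simp add: koszul_sign_def div_var_sign)
      have splitJ: "{1..m} - J = insert w ({1..<w} \<union> R)"
        unfolding split[symmetric] using wm wI[OF False] by (auto simp: J_def)
      \<comment> \<open>The cycle condition at \<open>J\<close>, divided by the variable
        \<open>w\<close>: terms with \<open>i < w\<close> vanish, \<open>i = w\<close> gives
        \<open>low\<close>, and those with \<open>i > w\<close> are the terms of the homotopy with
        opposite sign.\<close>
      have "0 = div_var w (koszul_map m a J j)" using cycle by simp
      also have "\<dots> = (\<Sum>i\<in>insert w ({1..<w} \<union> R). ?t i)"
        unfolding koszul_map_def div_var_sum splitJ ..
      also have "\<dots> = ?t w + ((\<Sum>i\<in>{1..<w}. ?t i) + (\<Sum>i\<in>R. ?t i))"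
        by (subst sum.insert; (subst sum.union_disjoint)?) (auto simp: R_def J_def)
      also have "(\<Sum>i\<in>{1..<w}. ?t i) = 0"
        unfolding t_eq by (intro sum.neutral) (simp add: div_var_var_mult)
      also have "?t w = low"
      proof -
        have "koszul_sign w J = (1 :: 'a mpol)" using w_le J by (intro koszul_sign_below) auto
        thus ?thesis unfolding t_eq by (simp add: div_var_var_mult low_def flip: J(1))
      qed
      also have "(\<Sum>i\<in>R. ?t i) = - (\<Sum>i\<in>R. koszul_sign i I * (var i * koszul_homotopy m a (insert i I) j))"
        unfolding sum_negf[symmetric]
      proof (rule sum.cong)
        fix i assume "i \<in> R"
        hence i: "i \<in> {1..m}" "i \<notin> I" "w < i" by (auto simp: R_def)
        have "Min (insert i I) = w"
          using i w_le wI[OF False] fin by (intro Min_eqI) (auto simp: less_imp_le)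
        moreover have "insert i I - {w} = insert i J" using i J by auto
        moreover have "koszul_sign i I = - (koszul_sign i J :: 'a mpol)"
          using i J by (simp add: koszul_sign_insert)
        ultimately show "?t i = - (koszul_sign i I * (var i * koszul_homotopy m a (insert i I) j))"
          using i I unfolding t_eq by (simp add: koszul_homotopy_def div_var_var_mult)
      qed simp
      finally show ?thesis by simp
    qed
    finally show ?thesis by simp
  qed
qed

section \<open>The resolution and its zigzags\<close>

lemma prod_monom: "(\<Prod>x\<in>A. monom (1::'a::comm_semiring_1) (f x)) = monom 1 (\<Sum>x\<in>A. f x)"
  by (induction A rule: infinite_finite_induct) (auto simp: mult_monom)

lemma subst_map_superset:
  assumes "finite A" "Poly_Mapping.keys p \<subseteq> A"
  shows "subst_map m d p = (\<Sum>t\<in>A. monom (Poly_Mapping.lookup p t) (wdeg m d t))"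
proof -
  have "subst_map m d p = (\<Sum>t\<in>Poly_Mapping.keys p. monom (Poly_Mapping.lookup p t) (wdeg m d t))"
    by (simp add: subst_map_def wdeg_def monom_power prod_monom smult_monom mult.commute)
  also have "\<dots> = (\<Sum>t\<in>A. monom (Poly_Mapping.lookup p t) (wdeg m d t))"
    using assms by (intro sum.mono_neutral_left) (auto simp: in_keys_iff)
  finally show ?thesis .
qed

lemma subst_map_add: "subst_map m d (p + q) = subst_map m d p + subst_map m d q"
proof -
  let ?A = "Poly_Mapping.keys p \<union> Poly_Mapping.keys q"
  have "subst_map m d r = (\<Sum>t\<in>?A. monom (Poly_Mapping.lookup r t) (wdeg m d t))"
    if "r \<in> {p, q, p + q}" for r
    using that keys_add[of p q] by (intro subst_map_superset) auto
  thus ?thesis by (simp add: lookup_add add_monom[symmetric] sum.distrib)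
qed

lemma subst_map_zero [simp]: "subst_map m d 0 = 0"
  by (simp add: subst_map_def)

lemma subst_map_sum: "subst_map m d (sum f A) = (\<Sum>x\<in>A. subst_map m d (f x))"
  by (induction A rule: infinite_finite_induct) (auto simp: subst_map_add)

lemma subst_map_uminus: "subst_map m d (- p) = - subst_map m d p"
  using subst_map_add[of m d p "- p"] by (simp add: eq_neg_iff_add_eq_0 add.commute)

lemma subst_map_diff: "subst_map m d (p - q) = subst_map m d p - subst_map m d q"
  using subst_map_add[of m d p "- q"] by (simp add: subst_map_uminus)

lemma subst_map_single: "subst_map m d (Poly_Mapping.single t c) = monom c (wdeg m d t)"
  by (subst subst_map_superset[of "{t}"]) auto

lemma wdeg_add: "wdeg m d (s + t) = wdeg m d s + wdeg m d t"
  by (simp add: wdeg_def lookup_add distrib_right sum.distrib)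

lemma wdeg_var: "i \<in> {1..m} \<Longrightarrow> wdeg m d (Poly_Mapping.single i (Suc 0)) = d i"
  by (simp add: wdeg_def lookup_single when_def if_distrib[where f = "\<lambda>x. x * _"] cong: if_cong)

lemma subst_map_mult: "subst_map m d (p * q) = subst_map m d p * subst_map m d q"
proof -
  have "subst_map m d (p * q) =
    (\<Sum>t\<in>Poly_Mapping.keys p. \<Sum>s\<in>Poly_Mapping.keys q.
      monom (Poly_Mapping.lookup p t) (wdeg m d t) * monom (Poly_Mapping.lookup q s) (wdeg m d s))"
    by (simp add: mult_eq_sum_single subst_map_sum subst_map_single wdeg_add mult_monom)
  also have "\<dots> = subst_map m d p * subst_map m d q"
    unfolding sum_product[symmetric] subst_map_superset[OF finite_keys order_refl] ..
  finally show ?thesis .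
qed

lemma subst_map_sign: "subst_map m d (koszul_sign i I) = (-1) ^ card {j\<in>I. j < i}"
proof -
  have one: "subst_map m d 1 = 1"
    using subst_map_single[of m d 0 1] by (simp add: wdeg_def)
  have "subst_map m d ((-1) ^ k) = (-1) ^ k" for k
    by (induction k) (auto simp: one subst_map_uminus)
  thus ?thesis by (simp add: koszul_sign_def)
qed

lemma mat_map_diff: "mat_map r b A (v - w) = mat_map r b A v - mat_map r b A w"
  by (intro ext) (simp add: mat_map_def right_diff_distrib sum_subtractf)

lemma mat_map_zero [simp]: "mat_map r b A 0 = 0"
  by (intro ext) (simp add: mat_map_def)

lemma mat_map_mult: "mat_map r b A (\<lambda>j. p * v j) = (\<lambda>k. p * mat_map r b A v k)"
  by (intro ext) (simp add: mat_map_def sum_distrib_left mult.left_commute)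

lemma koszul_map_mat_map:
  "koszul_map m (\<lambda>I. mat_map r b A (a I)) = (\<lambda>I. mat_map r b A (koszul_map m a I))"
proof (intro ext)
  fix I k
  show "koszul_map m (\<lambda>I. mat_map r b A (a I)) I k = mat_map r b A (koszul_map m a I) k"
  proof (cases "k \<in> {1..r}")
    case True
    have "(\<Sum>i\<in>{1..m} - I. \<Sum>j=1..b. koszul_sign i I * (var i * (A k j * a (insert i I) j))) =
      (\<Sum>j=1..b. \<Sum>i\<in>{1..m} - I. A k j * (koszul_sign i I * (var i * a (insert i I) j)))"
      by (subst sum.swap) (simp add: mult_ac)
    thus ?thesis using True by (simp add: koszul_map_def mat_map_def sum_distrib_left)
  qed (auto simp: koszul_map_def mat_map_def)
qed

locale semigroup_resolution = numerical_semigroup m d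
  for m :: nat and d :: "nat \<Rightarrow> nat" +
  fixes \<beta> :: "nat \<Rightarrow> nat" and C :: "nat \<Rightarrow> nat \<Rightarrow> nat"
    and \<phi> :: "nat \<Rightarrow> nat \<Rightarrow> nat \<Rightarrow> ('k::field_char_0) mpol"
  assumes m_ge: "2 \<le> m"
    and resolution: "minimal_graded_free_resolution m d \<beta> C \<phi>"
begin

definition D :: "nat \<Rightarrow> (nat \<Rightarrow> 'k mpol) \<Rightarrow> (nat \<Rightarrow> 'k mpol)" where
  "D i = mat_map (\<beta> (i-1)) (\<beta> i) (\<phi> i)"

text \<open>The complex is augmented by \<open>k[S]\<close>: at index 0 the outgoing map is the
  substitution.\<close>

definition cycle :: "nat \<Rightarrow> (nat \<Rightarrow> 'k mpol) \<Rightarrow> bool" where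
  "cycle i v \<longleftrightarrow> (if i = 0 then subst_map m d (v 1) = 0 else D i v = 0)"

lemma \<beta>0 [simp]: "\<beta> 0 = 1" "\<beta> 0 = Suc 0" and C0 [simp]: "C (Suc 0) 0 = 0"
  using resolution by (auto simp: minimal_graded_free_resolution_def)

lemma \<phi>_props:
  assumes "i \<in> {1..m-1}" "r \<in> {1..\<beta> (i-1)}" "j \<in> {1..\<beta> i}"
  shows \<phi>_poly_ring: "\<phi> i r j \<in> poly_ring m"
    and \<phi>_degree: "t \<in> Poly_Mapping.keys (\<phi> i r j) \<Longrightarrow> wdeg m d t + C r (i-1) = C j i"
    and \<phi>_const: "Poly_Mapping.lookup (\<phi> i r j) 0 = 0"
proof -
  have "\<forall>i\<in>{1..m-1}. \<forall>r\<in>{1..\<beta> (i-1)}. \<forall>j\<in>{1..\<beta> i}.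
        \<phi> i r j \<in> poly_ring m \<and>
        (\<forall>t\<in>Poly_Mapping.keys (\<phi> i r j). wdeg m d t + C r (i-1) = C j i) \<and>
        Poly_Mapping.lookup (\<phi> i r j) 0 = 0"
    using resolution unfolding minimal_graded_free_resolution_def by (elim conjE)
  with assms show "\<phi> i r j \<in> poly_ring m"
    "t \<in> Poly_Mapping.keys (\<phi> i r j) \<Longrightarrow> wdeg m d t + C r (i-1) = C j i"
    "Poly_Mapping.lookup (\<phi> i r j) 0 = 0" by blast+
qed

lemma D_diff: "D i (v - w) = D i v - D i w"
  by (simp add: D_def mat_map_diff)

lemma D_zero [simp]: "D i 0 = 0"
  by (simp add: D_def)

lemma D_free:
  assumes "i \<in> {1..m-1}" "v \<in> free_module m (\<beta> i)"
  shows "D i v \<in> free_module m (\<beta> (i-1))"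
  using assms \<phi>_poly_ring[OF assms(1)] free_module_entry[OF assms(2)]
  unfolding D_def mat_map_def free_module_def by (auto intro!: poly_ring_sum poly_ring_mult)

text \<open>Here minimality enters: images under \<open>D\<close> always satisfy the constant-term
  condition of \<open>koszul_exact\<close>.\<close>

lemma D_const:
  assumes "i \<in> {1..m-1}"
  shows "Poly_Mapping.lookup (D i v r) 0 = 0"
  using \<phi>_const[OF assms] by (auto simp: D_def mat_map_def lookup_sum lookup_mult_zero)

lemma exact:
  assumes "i < m - 1" "v \<in> free_module m (\<beta> i)"
  shows "cycle i v \<longleftrightarrow> (\<exists>w\<in>free_module m (\<beta> (Suc i)). D (Suc i) w = v)"
proof -
  have "D (Suc i) ` free_module m (\<beta> (Suc i)) = {v \<in> free_module m (\<beta> i). cycle i v}"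
  proof (cases "i = 0")
    case True
    thus ?thesis using resolution
      by (simp add: minimal_graded_free_resolution_def D_def cycle_def)
  next
    case False
    have "\<forall>i\<in>{1..<m-1}.
        mat_map (\<beta> i) (\<beta> (i+1)) (\<phi> (i+1)) ` free_module m (\<beta> (i+1))
          = {v \<in> free_module m (\<beta> i). mat_map (\<beta> (i-1)) (\<beta> i) (\<phi> i) v = (\<lambda>_. 0)}"
      using resolution unfolding minimal_graded_free_resolution_def by (elim conjE)
    thus ?thesis using False assms(1) by (simp add: D_def cycle_def zero_fun_def)
  qed
  hence "v \<in> D (Suc i) ` free_module m (\<beta> (Suc i)) \<longleftrightarrow> cycle i v"
    using assms(2) by simp
  thus ?thesis unfolding image_iff by metis
qed

lemma last_injective:
  assumes "v \<in> free_module m (\<beta> (m-1))" "cycle (m-1) v"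
  shows "v = 0"
proof -
  have "{v \<in> free_module m (\<beta> (m-1)). mat_map (\<beta> (m-2)) (\<beta> (m-1)) (\<phi> (m-1)) v = (\<lambda>_. 0)}
       = {\<lambda>_. 0}"
    using resolution unfolding minimal_graded_free_resolution_def by (elim conjE)
  moreover have "m - 1 \<noteq> 0" "m - 1 - 1 = m - 2" using m_ge by auto
  ultimately show ?thesis using assms unfolding cycle_def D_def zero_fun_def by auto
qed

lemma cycle_zero: "cycle i 0"
  by (simp add: cycle_def)

lemma koszul_map_D: "koszul_map m (\<lambda>I. D i (a I)) = (\<lambda>I. D i (koszul_map m a I))"
  unfolding D_def by (rule koszul_map_mat_map)

lemma D_chains:
  assumes "i \<in> {1..m-1}" "a \<in> koszul_chains m p (\<beta> i)"
  shows "(\<lambda>I. D i (a I)) \<in> koszul_chains m p (\<beta> (i-1))"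
  using assms D_free[OF assms(1)] unfolding koszul_chains_def by auto

lemma D_cycle: "D (Suc i) v \<in> free_module m (\<beta> i) \<and> cycle i (D (Suc i) v)"
  if "i < m - 1" "v \<in> free_module m (\<beta> (Suc i))"
  using exact[OF that(1), of "D (Suc i) v"] D_free[of "Suc i" v] that by auto

lemma exact_chains:
  assumes i: "i < m - 1" and a: "a \<in> koszul_chains m p (\<beta> i)" and cyc: "\<And>I. cycle i (a I)"
  shows "\<exists>b\<in>koszul_chains m p (\<beta> (Suc i)). (\<lambda>I. D (Suc i) (b I)) = a"
proof -
  have "\<exists>w\<in>free_module m (\<beta> (Suc i)). D (Suc i) w = a I" for I
    using exact[OF i koszul_chains_free[OF a]] cyc by blast
  then obtain w where w: "\<And>I. w I \<in> free_module m (\<beta> (Suc i))" "\<And>I. D (Suc i) (w I) = a I"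
    by metis
  define b where "b = (\<lambda>I. if I \<subseteq> {1..m} \<and> card I = p then w I else 0)"
  have "b \<in> koszul_chains m p (\<beta> (Suc i))"
    using w(1) by (auto simp: koszul_chains_def b_def)
  moreover have "(\<lambda>I. D (Suc i) (b I)) = a"
    using koszul_chains_outside[OF a] w(2) by (intro ext) (auto simp: b_def)
  ultimately show ?thesis by blast
qed

text \<open>A path through the double complex with entries \<open>F\<^sub>q \<otimes> \<Lambda>\<^sup>p\<close>, from \<open>a \<in> F\<^sub>0 \<otimes> \<Lambda>\<^sup>m\<^sup>-\<^sup>1\<close> to
  \<open>b \<in> F\<^sub>q \<otimes> \<Lambda>\<^sup>m\<^sup>-\<^sup>1\<^sup>-\<^sup>q\<close>.\<close>

primrec zigzag :: "nat \<Rightarrow> (nat set \<Rightarrow> nat \<Rightarrow> 'k mpol) \<Rightarrow> (nat set \<Rightarrow> nat \<Rightarrow> 'k mpol) \<Rightarrow> bool" where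
  "zigzag 0 a b \<longleftrightarrow> a \<in> koszul_chains m (m - 1) (\<beta> 0) \<and> a = b"
| "zigzag (Suc q) a b \<longleftrightarrow> b \<in> koszul_chains m (m - 1 - Suc q) (\<beta> (Suc q)) \<and>
     (\<exists>c. zigzag q a c \<and> koszul_map m c = (\<lambda>I. D (Suc q) (b I)))"

lemma zigzag_start: "zigzag q a b \<Longrightarrow> a \<in> koszul_chains m (m - 1) (\<beta> 0)"
  by (induction q arbitrary: b) auto

lemma zigzag_end: "zigzag q a b \<Longrightarrow> b \<in> koszul_chains m (m - 1 - q) (\<beta> q)"
  by (cases q) auto

text \<open>The two differentials commute, so \<open>D\<close> of the Koszul image of
  \<open>b\<close> is the twofold Koszul image of the preceding entry.\<close>

lemma zigzag_cycle:
  assumes "zigzag q a b" "\<And>I. cycle 0 (koszul_map m a I)"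
  shows "cycle q (koszul_map m b I)"
proof (cases q)
  case 0
  thus ?thesis using assms by simp
next
  case (Suc p)
  then obtain c where "koszul_map m c = (\<lambda>I. D q (b I))" using assms(1) by auto
  hence "koszul_map m (\<lambda>I. D q (b I)) = 0" using koszul_map_koszul_map by metis
  hence "D q (koszul_map m b I) = 0" using koszul_map_D[of q b] by (metis zero_fun_apply)
  thus ?thesis using Suc by (simp add: cycle_def)
qed

text \<open>Each step lifts a Koszul image through \<open>D\<close> by exactness of the
  resolution.\<close>

lemma zigzag_forward:
  assumes "a \<in> koszul_chains m (m - 1) (\<beta> 0)" "\<And>I. cycle 0 (koszul_map m a I)" "q \<le> m - 1"
  shows "\<exists>b. zigzag q a b"
  using assms(3)
proof (induction q)
  case 0
  thus ?case using assms(1) by auto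
next
  case (Suc q)
  then obtain c where c: "zigzag q a c" by auto
  have "m - 1 - q = Suc (m - 1 - Suc q)" using Suc.prems by simp
  hence "koszul_map m c \<in> koszul_chains m (m - 1 - Suc q) (\<beta> q)"
    using zigzag_end[OF c] by (simp add: koszul_map_chains)
  moreover have "cycle q (koszul_map m c I)" for I
    by (rule zigzag_cycle[OF c assms(2)])
  ultimately obtain b where "b \<in> koszul_chains m (m - 1 - Suc q) (\<beta> (Suc q))"
    "koszul_map m c = (\<lambda>I. D (Suc q) (b I))"
    using exact_chains[of q] Suc.prems by (metis Suc_le_lessD)
  thus ?case using c by (intro exI[of _ b]) auto
qed

text \<open>Each step lifts \<open>D\<close> of an entry through the Koszul map. The required cycle
  condition passes to the preceding entry because two successive maps \<open>D\<close> compose to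
  0.\<close>

lemma zigzag_backward:
  assumes "b \<in> koszul_chains m (m - 1 - q) (\<beta> q)" "q \<le> m - 1"
    "q \<noteq> 0 \<Longrightarrow> koszul_map m (\<lambda>I. D q (b I)) = 0"
  shows "\<exists>a. zigzag q a b"
  using assms
proof (induction q arbitrary: b)
  case 0
  thus ?case by auto
next
  case (Suc q)
  let ?e = "\<lambda>I. D (Suc q) (b I)"
  define c where "c = koszul_homotopy m ?e"
  have q: "Suc q \<in> {1..m-1}" "q < m - 1" using Suc.prems(2) by auto
  have e: "?e \<in> koszul_chains m (m - 1 - Suc q) (\<beta> q)"
    using D_chains[OF q(1) Suc.prems(1)] by simp
  have kc: "koszul_map m c = ?e"
    unfolding c_def
    by (rule koszul_exact[OF e]; (rule Suc.prems(3), simp)?) (rule D_const[OF q(1)])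
  have "m - 1 - q = Suc (m - 1 - Suc q)" using Suc.prems(2) by simp
  hence c: "c \<in> koszul_chains m (m - 1 - q) (\<beta> q)"
    unfolding c_def using koszul_homotopy_chains[OF e] by simp
  have "koszul_map m (\<lambda>I. D q (c I)) = 0" if "q \<noteq> 0"
  proof
    fix I
    have "koszul_map m (\<lambda>I. D q (c I)) I = D q (?e I)"
      by (simp add: koszul_map_D kc)
    also have "\<dots> = 0"
      using D_cycle[OF q(2) koszul_chains_free[OF Suc.prems(1), of I]] that by (simp add: cycle_def)
    finally show "koszul_map m (\<lambda>I. D q (c I)) I = 0 I" by simp
  qed
  then obtain a where "zigzag q a c" using Suc.IH[OF c] q by auto
  thus ?case using kc Suc.prems(1) by auto
qed

text \<open>The element is a Koszul boundary modulo the kernel of the map \<open>F\<^sub>q \<rightarrow> F\<^sub>q\<^sub>-\<^sub>1\<close>, i.e. its class in Koszul homology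
  of the \<open>q\<close>-th syzygy module vanishes. As \<open>q\<close> varies these homology groups are related by the connecting
  isomorphisms.\<close>

definition trivial :: "nat \<Rightarrow> (nat set \<Rightarrow> nat \<Rightarrow> 'k mpol) \<Rightarrow> bool" where
  "trivial q b \<longleftrightarrow> (\<exists>c\<in>koszul_chains m (m - q) (\<beta> q). \<forall>I. cycle q ((b - koszul_map m c) I))"

text \<open>Each induction step is one connecting isomorphism: the resolution lifts
  \<open>c - koszul_map m e\<close> to a chain \<open>f\<close> for \<open>b\<close>, and conversely
  Koszul exactness makes \<open>c\<close> minus the image of \<open>f\<close> a boundary.\<close>

lemma zigzag_trivial_iff:
  assumes "zigzag q a b" "q \<le> m - 1"
  shows "trivial 0 a \<longleftrightarrow> trivial q b"
  using assms
proof (induction q arbitrary: b)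
  case 0
  thus ?case by simp
next
  case (Suc q)
  then obtain c where c: "zigzag q a c" "koszul_map m c = (\<lambda>I. D (Suc q) (b I))"
    and b: "b \<in> koszul_chains m (m - 1 - Suc q) (\<beta> (Suc q))" by auto
  have q: "q < m - 1" "Suc q \<in> {1..m-1}" using Suc.prems by auto
  have mq: "m - q = Suc (m - Suc q)" "m - 1 - q = m - Suc q" using q by auto
  have cK: "c \<in> koszul_chains m (m - Suc q) (\<beta> q)" using zigzag_end[OF c(1)] mq by simp
  have "trivial q c \<longleftrightarrow> trivial (Suc q) b"
  proof
    assume "trivial q c"
    then obtain e where e: "e \<in> koszul_chains m (m - q) (\<beta> q)"
      "\<And>I. cycle q ((c - koszul_map m e) I)" unfolding trivial_def by blast
    have "c - koszul_map m e \<in> koszul_chains m (m - Suc q) (\<beta> q)"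
      using cK e(1) mq by (simp add: koszul_chains_diff koszul_map_chains)
    then obtain f where f: "f \<in> koszul_chains m (m - Suc q) (\<beta> (Suc q))"
      "(\<lambda>I. D (Suc q) (f I)) = c - koszul_map m e"
      using exact_chains[OF q(1)] e(2) by blast
    have "cycle (Suc q) ((b - koszul_map m f) I)" for I
    proof -
      have "koszul_map m (\<lambda>I. D (Suc q) (f I)) = koszul_map m c"
        by (simp add: f(2) koszul_map_diff koszul_map_koszul_map)
      hence "D (Suc q) (koszul_map m f I) = D (Suc q) (b I)"
        unfolding koszul_map_D c(2) by metis
      thus ?thesis by (simp add: cycle_def D_diff)
    qed
    thus "trivial (Suc q) b" using f(1) unfolding trivial_def by blast
  next
    assume "trivial (Suc q) b"
    then obtain f where f: "f \<in> koszul_chains m (m - Suc q) (\<beta> (Suc q))"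
      "\<And>I. cycle (Suc q) ((b - koszul_map m f) I)" unfolding trivial_def by blast
    let ?g = "\<lambda>I. D (Suc q) (f I)"
    have g: "?g \<in> koszul_chains m (m - Suc q) (\<beta> q)"
      using D_chains[OF q(2) f(1)] by simp
    define e where "e = koszul_homotopy m (c - ?g)"
    have "koszul_map m (c - ?g) = 0"
    proof
      fix I
      have "D (Suc q) (b I) = D (Suc q) (koszul_map m f I)"
        using f(2)[of I] by (simp add: cycle_def D_diff)
      thus "koszul_map m (c - ?g) I = 0 I"
        by (simp add: koszul_map_diff koszul_map_D c(2))
    qed
    \<comment> \<open>The exterior degree \<open>m - Suc q\<close> of \<open>c\<close> is positive,
      so \<open>c\<close> contributes no constant term at \<open>{}\<close>.\<close>
    moreover have "c {} j = 0" for j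
      using koszul_chains_outside[OF cK, of "{}"] q by simp
    ultimately have ke: "koszul_map m e = c - ?g"
      unfolding e_def using D_const[OF q(2)] 
      by (intro koszul_exact[OF koszul_chains_diff[OF cK g]]) (simp_all add: lookup_minus)
    have "e \<in> koszul_chains m (m - q) (\<beta> q)"
      unfolding e_def mq using koszul_homotopy_chains[OF koszul_chains_diff[OF cK g]] by simp
    moreover have "cycle q ((c - koszul_map m e) I)" for I
    proof -
      have "(c - koszul_map m e) I = ?g I" by (simp add: ke)
      thus ?thesis using D_cycle[OF q(1) koszul_chains_free[OF f(1), of I]] by simp
    qed
    ultimately show "trivial q c" unfolding trivial_def by blast
  qed
  thus ?case using Suc.IH[OF c(1)] q by simp
qed

text \<open>The last map is injective, so \<open>trivial\<close> means being a Koszul boundary; in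
  exterior degree 0 these are the elements of the maximal ideal times the module. The classes thus
  form the last module tensored with \<open>k\<close>.\<close>

lemma trivial_last:
  assumes b: "b \<in> koszul_chains m 0 (\<beta> (m-1))"
  shows "trivial (m-1) b \<longleftrightarrow> (\<forall>j. Poly_Mapping.lookup (b {} j) 0 = 0)"
proof
  assume "trivial (m-1) b"
  then obtain c where c: "c \<in> koszul_chains m (m - (m-1)) (\<beta> (m-1))"
    "\<And>I. cycle (m-1) ((b - koszul_map m c) I)" unfolding trivial_def by blast
  have "m - (m-1) = Suc 0" using m_ge by simp
  hence "koszul_map m c \<in> koszul_chains m 0 (\<beta> (m-1))" using c(1) koszul_map_chains by metis
  hence "(b - koszul_map m c) {} = 0"
    using last_injective c(2) koszul_chains_free[OF koszul_chains_diff[OF b]] by blast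
  hence "b {} = koszul_map m c {}" by simp
  moreover have "Poly_Mapping.lookup (koszul_map m c {} j) 0 = 0" for j
    by (simp add: koszul_map_def lookup_sum lookup_mult_zero lookup_single when_def poly_mapping_eq_iff fun_eq_iff)
  ultimately show "\<forall>j. Poly_Mapping.lookup (b {} j) 0 = 0" by simp
next
  assume const: "\<forall>j. Poly_Mapping.lookup (b {} j) 0 = 0"
  define c where "c = koszul_homotopy m b"
  have "koszul_map m b = 0" by (rule koszul_map_chains_0[OF b])
  hence "koszul_map m c = b" unfolding c_def using const by (intro koszul_exact[OF b]) auto
  moreover have "m - (m-1) = Suc 0" using m_ge by simp
  hence "c \<in> koszul_chains m (m - (m-1)) (\<beta> (m-1))"
    unfolding c_def using koszul_homotopy_chains[OF b] by simp
  ultimately show "trivial (m-1) b"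
    unfolding trivial_def using cycle_zero by (intro bexI[of _ c]) auto
qed

end

section \<open>Degrees of the last syzygies\<close>

lemma restrict_keys_sign:
  "restrict_keys P (koszul_sign i I * p) = koszul_sign i I * restrict_keys P p"
proof -
  have "restrict_keys P (- p) = - restrict_keys P p" for p :: "'a mpol"
    by (rule poly_mapping_eqI) (simp add: lookup_restrict_keys)
  hence "restrict_keys P ((-1) ^ k * p) = (-1) ^ k * restrict_keys P p" for k
    by (induction k) auto
  thus ?thesis by (simp add: koszul_sign_def)
qed

lemma koszul_chains_mult:
  assumes "s \<in> poly_ring m" "a \<in> koszul_chains m p r"
  shows "(\<lambda>I j. s * a I j) \<in> koszul_chains m p r"
  by (rule koszul_chainsI)
    (use koszul_chains_eq_0[OF assms(2)] in
      \<open>auto intro!: poly_ring_mult assms(1) koszul_chains_entry[OF assms(2)]\<close>)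

lemma koszul_map_mult: "koszul_map m (\<lambda>I j. s * a I j) = (\<lambda>I j. s * koszul_map m a I j)"
  by (intro ext) (simp add: koszul_map_def sum_distrib_left mult_ac)

lemma card_coatom_cases:
  assumes "I \<subseteq> {1..m}" "card I = m - 1" "0 < m"
  shows "\<exists>i\<in>{1..m}. I = {1..m} - {i}"
proof -
  have "card ({1..m} - I) = 1"
    using assms by (subst card_Diff_subset) (auto intro: finite_subset)
  then obtain i where i: "{1..m} - I = {i}" by (auto simp: card_1_singleton_iff)
  hence "I = {1..m} - {i}" "i \<in> {1..m}" using assms(1) by auto
  thus ?thesis by blast
qed

text \<open>The image is a multiple of one monomial, and evaluation at 1 reads off the
  scalar.\<close>

lemma subst_map_homogeneous:
  assumes "\<And>t. t \<in> Poly_Mapping.keys p \<Longrightarrow> wdeg m d t = k"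
  shows "subst_map m d p = monom (poly (subst_map m d p) 1) k"
proof -
  have "subst_map m d p = (\<Sum>t\<in>Poly_Mapping.keys p. monom (Poly_Mapping.lookup p t) k)"
    using assms by (simp add: subst_map_superset[OF finite_keys order_refl])
  also have "\<dots> = monom (\<Sum>t\<in>Poly_Mapping.keys p. Poly_Mapping.lookup p t) k"
    by (simp add: poly_eq_iff coeff_sum)
  finally have *: "subst_map m d p = monom (\<Sum>t\<in>Poly_Mapping.keys p. Poly_Mapping.lookup p t) k" .
  show ?thesis by (simp add: * poly_monom)
qed

lemma coeff_subst_map_nonzero:
  assumes "coeff (subst_map m d p) k \<noteq> 0"
  shows "\<exists>t\<in>Poly_Mapping.keys p. wdeg m d t = k"
proof (rule ccontr)
  assume "\<not> ?thesis"
  hence "coeff (subst_map m d p) k = 0"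
    by (auto simp: subst_map_superset[OF finite_keys order_refl] coeff_sum intro!: sum.neutral)
  thus False using assms by simp
qed

context numerical_semigroup
begin

lemma mem_iff_wdeg: "x \<in> S \<longleftrightarrow> (\<exists>t. Poly_Mapping.keys t \<subseteq> {1..m} \<and> int (wdeg m d t) = x)"
proof
  assume "x \<in> S"
  then obtain a where a: "x = int (\<Sum>i=1..m. a i * d i)" unfolding mem_semigroup ..
  define t where "t = (\<Sum>i=1..m. Poly_Mapping.single i (a i))"
  have lookup: "Poly_Mapping.lookup t j = (if j \<in> {1..m} then a j else 0)" for j
    by (simp add: t_def lookup_sum lookup_single when_def)
  have "wdeg m d t = (\<Sum>i=1..m. a i * d i)"
    unfolding wdeg_def by (intro sum.cong) (auto simp: lookup)
  moreover have "Poly_Mapping.keys t \<subseteq> {1..m}"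
    by (auto simp: in_keys_iff lookup split: if_splits)
  ultimately show "\<exists>t. Poly_Mapping.keys t \<subseteq> {1..m} \<and> int (wdeg m d t) = x" using a by auto
next
  assume "\<exists>t. Poly_Mapping.keys t \<subseteq> {1..m} \<and> int (wdeg m d t) = x"
  then obtain t where "x = int (wdeg m d t)" by blast
  thus "x \<in> S" unfolding mem_semigroup wdeg_def by blast
qed

text \<open>Generators suffice as tests: a nonzero element of \<open>S\<close> is a generator plus
  an element of \<open>S\<close>.\<close>

lemma pseudo_frobeniusI:
  assumes "x \<notin> S" "\<And>i. i \<in> {1..m} \<Longrightarrow> x + int (d i) \<in> S"
  shows "x \<in> pseudo_frobenius m d"
proof -
  have "x + s \<in> S" if "s \<in> S - {0}" for s
  proof -
    obtain t where t: "Poly_Mapping.keys t \<subseteq> {1..m}" "int (wdeg m d t) = s"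
      using \<open>s \<in> S - {0}\<close> mem_iff_wdeg by blast
    have "t \<noteq> 0" using that t by (auto simp: wdeg_def)
    then obtain i where i: "Poly_Mapping.lookup t i \<noteq> 0"
      by (auto simp: poly_mapping_eq_iff fun_eq_iff)
    hence "i \<in> Poly_Mapping.keys t" by (simp add: in_keys_iff)
    hence im: "i \<in> {1..m}" using t(1) by blast
    let ?e = "Poly_Mapping.single i (Suc 0)"
    have "wdeg m d t = wdeg m d (t - ?e) + d i"
      using exponent_add_diff[OF i] wdeg_add[of m d "t - ?e" ?e] wdeg_var[OF im] by simp
    hence "x + s = (x + int (d i)) + int (wdeg m d (t - ?e))" using t(2) by simp
    moreover have "Poly_Mapping.keys (t - ?e) \<subseteq> {1..m}"
      using t(1) by (auto simp: in_keys_iff lookup_minus subset_iff)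
    ultimately show ?thesis using add_in assms(2)[OF im] mem_iff_wdeg by metis
  qed
  thus ?thesis using assms(1) by (simp add: pseudo_frobenius_def)
qed

end

context semigroup_resolution
begin

section \<open>Homogeneous components of chains and zigzags\<close>

definition hom_part :: "nat \<Rightarrow> int \<Rightarrow> (nat \<Rightarrow> 'k mpol) \<Rightarrow> (nat \<Rightarrow> 'k mpol)" where
  "hom_part i c v j = restrict_keys (\<lambda>t. int (wdeg m d t) + int (C j i) = c) (v j)"

lemma hom_part_free: "v \<in> free_module m r \<Longrightarrow> hom_part i c v \<in> free_module m r"
  by (simp add: free_module_def hom_part_def poly_ring_restrict_keys)

lemma hom_part_zero [simp]: "hom_part i c 0 = 0"
  by (intro ext) (simp add: hom_part_def)

lemma D_hom_part:
  assumes "i \<in> {1..m-1}"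
  shows "D i (hom_part i c v) = hom_part (i-1) c (D i v)"
proof
  fix r
  show "D i (hom_part i c v) r = hom_part (i-1) c (D i v) r"
  proof (cases "r \<in> {1..\<beta> (i-1)}")
    case True
    have "\<phi> i r j * hom_part i c v j
       = restrict_keys (\<lambda>t. int (wdeg m d t) + int (C r (i-1)) = c) (\<phi> i r j * v j)"
      if "j \<in> {1..\<beta> i}" for j
      unfolding hom_part_def
    proof (rule restrict_keys_mult[symmetric])
      fix t s assume "t \<in> Poly_Mapping.keys (\<phi> i r j)"
      from \<phi>_degree[OF assms True that this]
      show "int (wdeg m d (t + s)) + int (C r (i - 1)) = c \<longleftrightarrow> int (wdeg m d s) + int (C j i) = c"
        by (auto simp: wdeg_add)
    qed
    thus ?thesis using True by (simp add: D_def mat_map_def hom_part_def restrict_keys_sum)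
  next
    case False
    thus ?thesis unfolding D_def mat_map_def hom_part_def by auto
  qed
qed

definition hom_chain ::
  "nat \<Rightarrow> int \<Rightarrow> (nat set \<Rightarrow> nat \<Rightarrow> 'k mpol) \<Rightarrow> (nat set \<Rightarrow> nat \<Rightarrow> 'k mpol)" where
  "hom_chain i c a I = hom_part i (c - (\<Sum>l\<in>I. int (d l))) (a I)"

lemma hom_chain_chains: "a \<in> koszul_chains m p r \<Longrightarrow> hom_chain i c a \<in> koszul_chains m p r"
  unfolding koszul_chains_def by (simp add: hom_chain_def hom_part_free split: if_splits)

lemma koszul_map_hom_chain:
  assumes a: "a \<in> koszul_chains m p r"
  shows "koszul_map m (hom_chain i c a) = hom_chain i c (koszul_map m a)"
proof (intro ext)
  fix I j
  let ?P = "\<lambda>I t. int (wdeg m d t) + int (C j i) = c - (\<Sum>l\<in>I. int (d l))"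
  have "var l * hom_chain i c a (insert l I) j = restrict_keys (?P I) (var l * a (insert l I) j)"
    if l: "l \<in> {1..m} - I" for l
  proof (cases "finite I")
    case True
    show ?thesis unfolding hom_chain_def hom_part_def
      by (rule restrict_keys_mult[symmetric]) (use True l in \<open>auto simp: wdeg_add wdeg_var\<close>)
  next
    \<comment> \<open>The sum over an infinite index set is 0 by default and does not record the
      degree shift, but chains vanish there.\<close>
    case False
    hence "a (insert l I) = 0"
      by (intro koszul_chains_outside[OF a]) (use finite_subset in auto)
    thus ?thesis by (simp add: hom_chain_def hom_part_def)
  qed
  thus "koszul_map m (hom_chain i c a) I j = hom_chain i c (koszul_map m a) I j"
    unfolding koszul_map_def
    by (simp add: hom_chain_def hom_part_def restrict_keys_sum restrict_keys_sign)
qed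

text \<open>Both differentials preserve the total degree in which \<open>e_I\<close> counts with the
  sum of \<open>d l\<close> over \<open>I\<close>, so all entries can be projected at once.\<close>

lemma zigzag_hom_chain:
  assumes "zigzag q a b" "q \<le> m - 1"
  shows "zigzag q (hom_chain 0 c a) (hom_chain q c b)"
  using assms
proof (induction q arbitrary: b)
  case 0
  thus ?case by (auto intro: hom_chain_chains)
next
  case (Suc q)
  then obtain e where e: "zigzag q a e" "koszul_map m e = (\<lambda>I. D (Suc q) (b I))" by auto
  have "koszul_map m (hom_chain q c e) = (\<lambda>I. D (Suc q) (hom_chain (Suc q) c b I))"
    unfolding koszul_map_hom_chain[OF zigzag_end[OF e(1)]] e(2)
    using D_hom_part[of "Suc q"] Suc.prems(2) by (intro ext) (simp add: hom_chain_def)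
  moreover have "zigzag q (hom_chain 0 c a) (hom_chain q c e)"
    using Suc.IH[OF e(1)] Suc.prems(2) by simp
  ultimately show ?case using Suc.prems(1) hom_chain_chains by auto
qed

lemma zigzag_mult:
  assumes "zigzag q a b" "s \<in> poly_ring m"
  shows "zigzag q (\<lambda>I j. s * a I j) (\<lambda>I j. s * b I j)"
  using assms(1)
proof (induction q arbitrary: b)
  case 0
  thus ?case using koszul_chains_mult[OF assms(2)] by auto
next
  case (Suc q)
  then obtain e where e: "zigzag q a e" "koszul_map m e = (\<lambda>I. D (Suc q) (b I))" by auto
  have "koszul_map m (\<lambda>I j. s * e I j) = (\<lambda>I. D (Suc q) (\<lambda>j. s * b I j))"
    unfolding koszul_map_mult e(2) D_def mat_map_mult ..
  thus ?case using Suc.IH[OF e(1)] Suc.prems koszul_chains_mult[OF assms(2)] by auto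
qed

lemma zigzag_diff:
  assumes "zigzag q a b" "zigzag q a' b'"
  shows "zigzag q (a - a') (b - b')"
  using assms
proof (induction q arbitrary: b b')
  case 0
  thus ?case unfolding zigzag.simps using koszul_chains_diff by metis
next
  case (Suc q)
  from Suc.prems(1) obtain e where e: "zigzag q a e" "koszul_map m e = (\<lambda>I. D (Suc q) (b I))" by auto
  from Suc.prems(2) obtain e' where e': "zigzag q a' e'" "koszul_map m e' = (\<lambda>I. D (Suc q) (b' I))" by auto
  have "koszul_map m (e - e') = (\<lambda>I. D (Suc q) ((b - b') I))"
    unfolding koszul_map_diff e(2) e'(2) by (intro ext) (simp add: D_diff)
  moreover have "b - b' \<in> koszul_chains m (m - 1 - Suc q) (\<beta> (Suc q))"
    using Suc.prems by (intro koszul_chains_diff) (simp_all only: zigzag.simps)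
  ultimately show ?case
    unfolding zigzag.simps using Suc.IH[OF e(1) e'(1)] by blast
qed

lemma zigzag_start_cycle:
  assumes "zigzag q a b" "0 < q" "q \<le> m - 1"
  shows "cycle 0 (koszul_map m a I)"
  using assms
proof (induction q arbitrary: b)
  case (Suc q)
  then obtain e where e: "zigzag q a e" "koszul_map m e = (\<lambda>I. D (Suc q) (b I))" by auto
  show ?case
  proof (cases "q = 0")
    case True
    thus ?thesis using e D_cycle[of 0 "b I"] koszul_chains_free[OF zigzag_end[OF Suc.prems(1)]] Suc.prems
      by auto
  qed (use Suc e in auto)
qed simp

abbreviation "\<Sigma> \<equiv> gen_sum m d"

lemma m_pos: "0 < m"
  using m_ge by simp

text \<open>If \<open>a\<close> is homogeneous of degree \<open>c\<close>, a Koszul cycle over \<open>k[S]\<close> of this shape is the boundary of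
  \<open>top_coeff a 1 * z ^ (c - \<Sigma>) \<otimes> e\<^bsub>{1..m}\<^esub>\<close> over \<open>k[z, 1/z]\<close>.\<close>

definition top_coeff :: "(nat set \<Rightarrow> nat \<Rightarrow> 'k mpol) \<Rightarrow> nat \<Rightarrow> 'k" where
  "top_coeff a i = poly (subst_map m d (a ({1..m} - {i}) 1)) 1"

lemma top_coeff_eq:
  assumes cyc: "\<And>I. cycle 0 (koszul_map m a I)" and i: "i \<in> {1..m}"
  shows "top_coeff a i = (-1) ^ card {j \<in> {1..m} - {i}. j < i} * top_coeff a 1"
proof (cases "i = 1")
  case True
  hence *: "{j \<in> {1..m} - {i}. j < i} = {}" by auto
  show ?thesis unfolding * unfolding True by simp
next
  case False
  \<comment> \<open>Only the two indices 1 and \<open>i\<close> are missing, so the cycle condition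
    at \<open>J\<close> relates just two coefficients of \<open>a\<close>; evaluation at
    \<open>z = 1\<close> then removes the monomials.\<close>
  define J where "J = {1..m} - {1, i}"
  have im: "i > 1" "1 \<in> {1..m}" using False i by auto
  have J: "{1..m} - J = {1, i}" "insert 1 J = {1..m} - {i}" "insert i J = {1..m} - {1}"
    using im i by (auto simp: J_def)
  have "koszul_map m a J 1 = koszul_sign 1 J * (var 1 * a ({1..m} - {i}) 1)
      + koszul_sign i J * (var i * a ({1..m} - {1}) 1)"
    unfolding koszul_map_def J(1) using False J by simp
  hence "0 = subst_map m d (koszul_sign 1 J * (var 1 * a ({1..m} - {i}) 1)
      + koszul_sign i J * (var i * a ({1..m} - {1}) 1))"
    using cyc[of J] by (simp add: cycle_def)
  hence "poly 0 1 = poly (subst_map m d (koszul_sign 1 J * (var 1 * a ({1..m} - {i}) 1)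
      + koszul_sign i J * (var i * a ({1..m} - {1}) 1))) 1" by simp
  moreover have "koszul_sign 1 J = (1 :: 'k mpol)"
    by (rule koszul_sign_below) (auto simp: J_def)
  ultimately have *: "top_coeff a i + (-1) ^ card {j\<in>J. j < i} * top_coeff a 1 = 0"
    by (simp add: subst_map_add subst_map_mult subst_map_sign subst_map_single poly_monom
        top_coeff_def del: One_nat_def)
  have "{j \<in> {1..m} - {i}. j < i} = insert 1 {j\<in>J. j < i}"
    using im i by (auto simp: J_def)
  hence sign: "(-1 :: 'k) ^ card {j \<in> {1..m} - {i}. j < i} = - ((-1) ^ card {j\<in>J. j < i})"
    by (simp add: J_def)
  show ?thesis unfolding sign using * by (simp add: eq_neg_iff_add_eq_0)
qed

lemma top_degree:
  assumes hom: "hom_chain 0 c a = a" and i: "i \<in> {1..m}"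
    and t: "t \<in> Poly_Mapping.keys (a ({1..m} - {i}) 1)"
  shows "int (wdeg m d t) = c - \<Sigma> + int (d i)"
proof -
  have "t \<in> Poly_Mapping.keys (hom_chain 0 c a ({1..m} - {i}) 1)" using hom t by simp
  thus ?thesis using i by (simp add: hom_chain_def hom_part_def keys_restrict_keys gen_sum_def sum_diff1)
qed

text \<open>In both cases the boundary description over \<open>k[z, 1/z]\<close> already holds over
  \<open>k[S]\<close>; the chain \<open>e\<close> lifts
  \<open>top_coeff a 1 * z ^ (c - \<Sigma>)\<close> to the polynomial ring.\<close>

lemma trivial_top:
  assumes a: "a \<in> koszul_chains m (m - 1) (\<beta> 0)" and cyc: "\<And>I. cycle 0 (koszul_map m a I)"
    and hom: "hom_chain 0 c a = a" and triv: "top_coeff a 1 = 0 \<or> c - \<Sigma> \<in> S"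
  shows "trivial 0 a"
proof -
  obtain t where t: "Poly_Mapping.keys t \<subseteq> {1..m}"
    "top_coeff a 1 = 0 \<or> int (wdeg m d t) = c - \<Sigma>"
  proof (cases "c - \<Sigma> \<in> S")
    case True
    thus ?thesis using that mem_iff_wdeg by blast
  next
    case False
    \<comment> \<open>Here \<open>top_coeff a 1 = 0\<close>, so \<open>e\<close> will be 0; the
      exponent 0 is a placeholder.\<close>
    thus ?thesis using triv that[of 0] by simp
  qed
  define e :: "nat set \<Rightarrow> nat \<Rightarrow> 'k mpol" where "e = (\<lambda>I j. if I = {1..m} \<and> j = 1 then Poly_Mapping.single t (top_coeff a 1) else 0)"
  have m: "Suc (m - 1) = m" using m_ge by simp
  have e: "e \<in> koszul_chains m m (\<beta> 0)"
  proof (rule koszul_chainsI)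
    show "e I j \<in> poly_ring m" for I j
      by (simp add: e_def poly_ring_single[OF t(1)])
  qed (auto simp: e_def)
  hence ke: "koszul_map m e \<in> koszul_chains m (m - 1) (\<beta> 0)"
    using koszul_map_chains[of e m "m - 1"] m by simp
  have "cycle 0 ((a - koszul_map m e) I)" for I
  proof (cases "I \<subseteq> {1..m} \<and> card I = m - 1")
    case False
    thus ?thesis using koszul_chains_outside[OF koszul_chains_diff[OF a ke]] cycle_zero by metis
  next
    case True
    then obtain i where i: "i \<in> {1..m}" "I = {1..m} - {i}" using card_coatom_cases[of I m] m_pos by blast
    have "{1..m} - I = {i}" "insert i I = {1..m}" using i by auto
    hence "koszul_map m e I 1 = koszul_sign i I * (var i * Poly_Mapping.single t (top_coeff a 1))"
      by (simp add: koszul_map_def e_def)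
    hence "subst_map m d (koszul_map m e I 1)
        = (-1) ^ card {j \<in> {1..m} - {i}. j < i} * monom (top_coeff a 1) (d i + wdeg m d t)"
      using i by (simp add: subst_map_mult subst_map_sign subst_map_single wdeg_var mult_monom)
    also have "\<dots> = monom (top_coeff a i) (d i + wdeg m d t)"
    proof -
      have "(-1) ^ k * monom u l = monom ((-1) ^ k * u) l" for k l and u :: 'k
        by (induction k) (auto simp: minus_monom)
      thus ?thesis using top_coeff_eq[OF cyc i(1)] by simp
    qed
    also have "\<dots> = subst_map m d (a I 1)"
    proof (cases "top_coeff a 1 = 0")
      case True
      hence "top_coeff a i = 0" using top_coeff_eq[OF cyc i(1)] by simp
      moreover have "subst_map m d (a I 1) = monom (top_coeff a i) (nat (c - \<Sigma> + int (d i)))"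
        unfolding top_coeff_def i(2)
        by (intro subst_map_homogeneous) (metis top_degree[OF hom i(1)] nat_int)
      ultimately show ?thesis by simp
    next
      case False
      hence "int (wdeg m d t) = c - \<Sigma>" using t(2) by simp
      thus ?thesis unfolding top_coeff_def i(2)
        using top_degree[OF hom i(1)] by (intro subst_map_homogeneous[symmetric]) force
    qed
    finally show ?thesis by (simp add: cycle_def subst_map_diff)
  qed
  thus ?thesis using e unfolding trivial_def by (intro bexI[of _ e]) auto
qed

text \<open>If \<open>top_coeff a 1\<close> is nonzero, so is every \<open>top_coeff a i\<close>; a
  monomial of the corresponding coefficient of \<open>a\<close> then has degree
  \<open>c - \<Sigma> + d i\<close>.\<close>

lemma nontrivial_pseudo_frobenius:
  assumes a: "a \<in> koszul_chains m (m - 1) (\<beta> 0)" and cyc: "\<And>I. cycle 0 (koszul_map m a I)"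
    and hom: "hom_chain 0 c a = a" and nontriv: "\<not> trivial 0 a"
  shows "c - \<Sigma> \<in> pseudo_frobenius m d"
proof (rule pseudo_frobeniusI)
  have *: "top_coeff a 1 \<noteq> 0" "c - \<Sigma> \<notin> S" using trivial_top[OF a cyc hom] nontriv by auto
  show "c - \<Sigma> \<notin> S" by fact
  fix i assume i: "i \<in> {1..m}"
  have "top_coeff a i \<noteq> 0" using top_coeff_eq[OF cyc i] * by simp
  hence "a ({1..m} - {i}) 1 \<noteq> 0" by (auto simp: top_coeff_def)
  then obtain t where t: "t \<in> Poly_Mapping.keys (a ({1..m} - {i}) 1)"
    by (metis all_not_in_conv keys_eq_empty)
  have "Poly_Mapping.keys t \<subseteq> {1..m}"
    using koszul_chains_entry[OF a] t unfolding poly_ring_def by blast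
  thus "c - \<Sigma> + int (d i) \<in> S"
    using top_degree[OF hom i t] mem_iff_wdeg by metis
qed

section \<open>Last syzygies and pseudo-Frobenius numbers\<close>

definition basis_chain :: "nat \<Rightarrow> nat set \<Rightarrow> nat \<Rightarrow> 'k mpol" where
  "basis_chain j I k = (if I = {} \<and> k = j then 1 else 0)"

lemma basis_chain_chains: "j \<in> {1..r} \<Longrightarrow> basis_chain j \<in> koszul_chains m 0 r"
  by (rule koszul_chainsI) (auto simp: basis_chain_def poly_ring_one)

text \<open>\<open>zigzag_backward\<close> does not control degrees; projecting to the degree of the
  basis vector fixes this and leaves the end of the zigzag unchanged.\<close>

lemma basis_zigzag:
  assumes j: "j \<in> {1..\<beta> (m-1)}"
  shows "\<exists>a. zigzag (m-1) a (basis_chain j) \<and> hom_chain 0 (int (C j (m-1))) a = a \<and>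
    (\<forall>I. cycle 0 (koszul_map m a I))"
proof -
  let ?c = "int (C j (m-1))"
  have b: "basis_chain j \<in> koszul_chains m 0 (\<beta> (m-1))" using basis_chain_chains[OF j] .
  have "(\<lambda>I. D (m-1) (basis_chain j I)) \<in> koszul_chains m 0 (\<beta> (m-1-1))"
    using D_chains[OF _ b] m_ge by simp
  hence "koszul_map m (\<lambda>I. D (m-1) (basis_chain j I)) = 0" by (rule koszul_map_chains_0)
  then obtain a where a: "zigzag (m-1) a (basis_chain j)"
    using zigzag_backward[of "basis_chain j" "m-1"] b by auto
  have "hom_chain (m-1) ?c (basis_chain j) = basis_chain j"
  proof (intro ext)
    fix I k
    have "restrict_keys (\<lambda>t. int (wdeg m d t) + ?c = ?c) 1 = (1 :: 'k mpol)"
      by (rule restrict_keys_eq_self) (simp add: wdeg_def)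
    thus "hom_chain (m-1) ?c (basis_chain j) I k = basis_chain j I k"
      by (auto simp: hom_chain_def hom_part_def basis_chain_def)
  qed
  hence z: "zigzag (m-1) (hom_chain 0 ?c a) (basis_chain j)"
    using zigzag_hom_chain[OF a, of ?c] by simp
  moreover have "hom_chain 0 ?c (hom_chain 0 ?c a) = hom_chain 0 ?c a"
    by (intro ext poly_mapping_eqI) (simp add: hom_chain_def hom_part_def lookup_restrict_keys)
  moreover have "cycle 0 (koszul_map m (hom_chain 0 ?c a) I)" for I
    using zigzag_start_cycle[OF z] m_ge by simp
  ultimately show ?thesis by blast
qed

lemma zigzag_trivial_last:
  assumes "zigzag (m-1) a b"
  shows "trivial 0 a \<longleftrightarrow> (\<forall>j. Poly_Mapping.lookup (b {} j) 0 = 0)"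
  using zigzag_trivial_iff[OF assms] trivial_last[of b] zigzag_end[OF assms] by simp

lemma last_degree_pseudo_frobenius:
  assumes j: "j \<in> {1..\<beta> (m-1)}"
  shows "int (C j (m-1)) - \<Sigma> \<in> pseudo_frobenius m d"
proof -
  obtain a where a: "zigzag (m-1) a (basis_chain j)" "hom_chain 0 (int (C j (m-1))) a = a"
    "\<And>I. cycle 0 (koszul_map m a I)" using basis_zigzag[OF j] by blast
  have "\<not> trivial 0 a"
    unfolding zigzag_trivial_last[OF a(1)] by (auto simp: basis_chain_def intro!: exI[of _ j])
  thus ?thesis using nontrivial_pseudo_frobenius[OF zigzag_start[OF a(1)] a(3,2)] by blast
qed

text \<open>Each degree contributes at most one dimension: modulo trivial chains a homogeneous cycle
  is determined by its \<open>top_coeff\<close> at 1.\<close>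

lemma last_degrees_inj: "inj_on (\<lambda>j. C j (m-1)) {1..\<beta> (m-1)}"
proof (rule inj_onI, rule ccontr)
  fix j j' assume j: "j \<in> {1..\<beta> (m-1)}" "j' \<in> {1..\<beta> (m-1)}"
    and eq: "C j (m-1) = C j' (m-1)" and neq: "j \<noteq> j'"
  let ?c = "int (C j (m-1))"
  obtain a where a: "zigzag (m-1) a (basis_chain j)" "hom_chain 0 ?c a = a"
    "\<And>I. cycle 0 (koszul_map m a I)" using basis_zigzag[OF j(1)] by blast
  obtain a' where a': "zigzag (m-1) a' (basis_chain j')" "hom_chain 0 ?c a' = a'"
    "\<And>I. cycle 0 (koszul_map m a' I)" using basis_zigzag[OF j(2)] unfolding eq by blast
  \<comment> \<open>The scalars are taken crosswise so that the top coefficients cancel in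
    \<open>u\<close>; triviality of \<open>u\<close> then forces the coefficient of the
    \<open>j\<close>-th basis vector, \<open>top_coeff a' 1\<close>, to be 0.\<close>
  define s :: "'k mpol" where "s = Poly_Mapping.single 0 (top_coeff a' 1)"
  define s' :: "'k mpol" where "s' = Poly_Mapping.single 0 (top_coeff a 1)"
  have ss: "s \<in> poly_ring m" "s' \<in> poly_ring m"
    unfolding s_def s'_def by (auto intro: poly_ring_single)
  define u where "u = (\<lambda>I j. s * a I j) - (\<lambda>I j. s' * a' I j)"
  have u: "zigzag (m-1) u ((\<lambda>I k. s * basis_chain j I k) - (\<lambda>I k. s' * basis_chain j' I k))"
    unfolding u_def using a(1) a'(1) ss by (intro zigzag_diff zigzag_mult)
  have "hom_chain 0 ?c u = u"
  proof (intro ext)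
    fix I k
    let ?P = "\<lambda>t. int (wdeg m d t) + int (C k 0) = ?c - (\<Sum>l\<in>I. int (d l))"
    have "restrict_keys ?P (Poly_Mapping.single 0 x * p) = Poly_Mapping.single 0 x * restrict_keys ?P p"
      for x :: 'k and p
      by (rule restrict_keys_mult) (auto split: if_splits)
    moreover have "restrict_keys ?P (a I k) = a I k" "restrict_keys ?P (a' I k) = a' I k"
      using fun_cong[OF fun_cong[OF a(2), of I], of k] fun_cong[OF fun_cong[OF a'(2), of I], of k]
      by (simp_all add: hom_chain_def hom_part_def)
    moreover have "restrict_keys ?P (p - q) = restrict_keys ?P p - restrict_keys ?P q" for p q :: "'k mpol"
      by (rule poly_mapping_eqI) (simp add: lookup_restrict_keys lookup_minus)
    ultimately show "hom_chain 0 ?c u I k = u I k"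
      by (simp add: hom_chain_def hom_part_def u_def s_def s'_def)
  qed
  moreover have "cycle 0 (koszul_map m u I)" for I
    using zigzag_start_cycle[OF u] m_ge by simp
  moreover have "top_coeff u 1 = 0"
    by (simp add: u_def s_def s'_def top_coeff_def subst_map_diff subst_map_mult subst_map_single poly_monom)
  ultimately have "trivial 0 u"
    using trivial_top[OF zigzag_start[OF u]] by blast
  hence "Poly_Mapping.lookup (s * basis_chain j {} j - s' * basis_chain j' {} j) 0 = 0"
    unfolding zigzag_trivial_last[OF u] by simp
  hence "top_coeff a' 1 = 0"
    using neq by (simp add: basis_chain_def s_def)
  hence "trivial 0 a'"
    using trivial_top[OF zigzag_start[OF a'(1)] a'(3,2)] by blast
  hence "Poly_Mapping.lookup (basis_chain j' {} j') 0 = (0 :: 'k)"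
    unfolding zigzag_trivial_last[OF a'(1)] by blast
  thus False by (simp add: basis_chain_def)
qed

text \<open>The cycle \<open>a\<close> lifts the Koszul image of \<open>z ^ x\<close> times the top
  exterior vector. That element exists only over \<open>k[z, 1/z]\<close>, while its image has
  coefficients \<open>z ^ (x + d i)\<close> up to sign, which lie in \<open>k[S]\<close>.\<close>

lemma pseudo_frobenius_last_degree:
  assumes x: "x \<in> pseudo_frobenius m d"
  shows "\<exists>j\<in>{1..\<beta> (m-1)}. int (C j (m-1)) = x + \<Sigma>"
proof -
  have xS: "x \<notin> S" using x by (simp add: pseudo_frobenius_def)
  have "\<exists>t. Poly_Mapping.keys t \<subseteq> {1..m} \<and> int (wdeg m d t) = x + int (d i)" if i: "i \<in> {1..m}" for i
  proof -
    have "x + int (d i) \<in> S"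
      using x generator_in[OF i] pos[OF i] by (auto simp: pseudo_frobenius_def)
    thus ?thesis using mem_iff_wdeg by blast
  qed
  then obtain t where t: "\<And>i. i \<in> {1..m} \<Longrightarrow> Poly_Mapping.keys (t i) \<subseteq> {1..m}"
    "\<And>i. i \<in> {1..m} \<Longrightarrow> int (wdeg m d (t i)) = x + int (d i)"
    by metis
  define a :: "nat set \<Rightarrow> nat \<Rightarrow> 'k mpol" where
    "a = (\<lambda>I j. if I \<subseteq> {1..m} \<and> card I = m - 1 \<and> j = 1 then
        koszul_sign (Min ({1..m} - I)) I * Poly_Mapping.single (t (Min ({1..m} - I))) 1 else 0)"
  have card_coatom: "card ({1..m} - {i}) = m - 1" if "i \<in> {1..m}" for i
    using that by simp
  have a_coatom: "a ({1..m} - {i}) 1 = koszul_sign i ({1..m} - {i}) * Poly_Mapping.single (t i) 1"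
    if i: "i \<in> {1..m}" for i
  proof -
    have "{1..m} - ({1..m} - {i}) = {i}" using i by auto
    hence "Min ({1..m} - ({1..m} - {i})) = i" by simp
    thus ?thesis using card_coatom[OF i] unfolding a_def by (simp only: if_True simp_thms Diff_subset)
  qed
  have a: "a \<in> koszul_chains m (m - 1) (\<beta> 0)"
  proof (rule koszul_chainsI)
    fix I j assume I: "I \<subseteq> {1..m}" "card I = m - 1" and j: "j \<in> {1..\<beta> 0}"
    then obtain i where i: "i \<in> {1..m}" "I = {1..m} - {i}" using card_coatom_cases[of I m] m_pos by blast
    show "a I j \<in> poly_ring m"
      using j a_coatom[OF i(1)] unfolding i(2) koszul_sign_def
      by (simp add: poly_ring_mult poly_ring_sign poly_ring_single[OF t(1)[OF i(1)]])
  qed (auto simp: a_def)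
  have cyc: "cycle 0 (koszul_map m a J)" for J
  proof (cases "J \<subseteq> {1..m} \<and> card J = m - 2")
    case False
    moreover have "koszul_map m a \<in> koszul_chains m (m - 2) (\<beta> 0)"
      using koszul_map_chains[of a m "m - 2"] a m_ge by (simp add: Suc_diff_Suc numeral_2_eq_2)
    ultimately show ?thesis using koszul_chains_outside cycle_zero by metis
  next
    case True
    hence "card ({1..m} - J) = 2"
      using m_ge by (subst card_Diff_subset) (auto intro: finite_subset)
    then obtain i l where il: "{1..m} - J = {i, l}" "i \<noteq> l" by (auto simp: card_2_iff)
    hence im: "i \<in> {1..m}" "l \<in> {1..m}" "i \<notin> J" "l \<notin> J" by auto
    have coatoms: "insert i J = {1..m} - {l}" "insert l J = {1..m} - {i}"
      using il True by auto
    have deg: "d i + wdeg m d (t l) = d l + wdeg m d (t i)"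
      using t(2)[OF im(1)] t(2)[OF im(2)] by linarith
    have "koszul_map m a J 1
        = koszul_sign i J * (var i * (koszul_sign l (insert i J) * Poly_Mapping.single (t l) 1))
        + koszul_sign l J * (var l * (koszul_sign i (insert l J) * Poly_Mapping.single (t i) 1))"
      unfolding koszul_map_def il(1) using il(2) im by (simp add: coatoms a_coatom[simplified])
    also have "\<dots> = (koszul_sign i J * koszul_sign l (insert i J)) * (var i * Poly_Mapping.single (t l) 1)
        + (koszul_sign l J * koszul_sign i (insert l J)) * (var l * Poly_Mapping.single (t i) 1)"
      by (simp only: mult_ac)
    also have "\<dots> = (koszul_sign i J * koszul_sign l (insert i J)) *
        (var i * Poly_Mapping.single (t l) 1 - var l * Poly_Mapping.single (t i) 1)"
      unfolding koszul_sign_antisym[OF il(2) im(3,4)] by (simp add: algebra_simps)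
    finally show ?thesis
      using im deg by (simp add: cycle_def subst_map_mult subst_map_diff subst_map_single wdeg_var mult_monom)
  qed
  \<comment> \<open>A bounding chain would contain at \<open>{1..m}\<close> a monomial of degree
    \<open>x\<close>, a gap; comparing the coefficient at the subset without 1 is enough.\<close>
  have nontriv: "\<not> trivial 0 a"
  proof
    have one: "1 \<in> {1..m}" using m_ge by simp
    assume "trivial 0 a"
    then obtain e where e: "e \<in> koszul_chains m m (\<beta> 0)" "cycle 0 ((a - koszul_map m e) ({1..m} - {1}))"
      unfolding trivial_def by auto
    have sign: "koszul_sign 1 ({1..m} - {1}) = (1 :: 'k mpol)"
      by (rule koszul_sign_below) auto
    have "{1..m} - ({1..m} - {1}) = {1}" "insert 1 ({1..m} - {1}) = {1..m}" using one by auto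
    hence "koszul_map m e ({1..m} - {1}) 1 = var 1 * e {1..m} 1"
      using sign by (simp add: koszul_map_def)
    hence "subst_map m d (a ({1..m} - {1}) 1) = subst_map m d (var 1 * e {1..m} 1)"
      using e(2) by (simp add: cycle_def subst_map_diff)
    hence "monom 1 (wdeg m d (t 1)) = monom 1 (d 1) * subst_map m d (e {1..m} 1)"
      using a_coatom[OF one] sign one by (simp add: subst_map_mult subst_map_single wdeg_var)
    hence "coeff (monom 1 (d 1) * subst_map m d (e {1..m} 1)) (wdeg m d (t 1)) = 1"
      by (metis coeff_monom)
    hence "d 1 \<le> wdeg m d (t 1)" "coeff (subst_map m d (e {1..m} 1)) (wdeg m d (t 1) - d 1) \<noteq> 0"
      by (auto simp: coeff_monom_mult split: if_splits)
    then obtain r where "r \<in> Poly_Mapping.keys (e {1..m} 1)" "int (wdeg m d r) = x"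
      using coeff_subst_map_nonzero t(2)[OF one] by (metis (no_types, lifting) add_diff_cancel_right' of_nat_diff)
    thus False using xS mem_iff_wdeg koszul_chains_entry[OF e(1)] unfolding poly_ring_def by blast
  qed
  obtain b where b: "zigzag (m-1) a b" using zigzag_forward[OF a cyc] by blast
  let ?c = "x + \<Sigma>"
  have "hom_chain 0 ?c a = a"
  proof (intro ext)
    fix I j
    show "hom_chain 0 ?c a I j = a I j"
    proof (cases "I \<subseteq> {1..m} \<and> card I = m - 1 \<and> j = 1")
      case True
      then obtain i where i: "i \<in> {1..m}" "I = {1..m} - {i}" using card_coatom_cases[of I m] m_pos by blast
      have "a I j = koszul_sign i I * Poly_Mapping.single (t i) 1"
        using a_coatom[OF i(1)] i True by simp
      moreover have "int (wdeg m d (t i)) + int (C j 0) = ?c - (\<Sum>l\<in>I. int (d l))"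
        using t(2)[OF i(1)] True i by (simp add: gen_sum_def sum_diff1)
      ultimately show ?thesis
        unfolding hom_chain_def hom_part_def by (simp add: restrict_keys_sign restrict_keys_single)
    next
      case False
      hence "a I j = 0" unfolding a_def by (rule if_not_P)
      thus ?thesis by (simp add: hom_chain_def hom_part_def)
    qed
  qed
  hence z: "zigzag (m-1) a (hom_chain (m-1) ?c b)"
    using zigzag_hom_chain[OF b, of ?c] by simp
  then obtain j where j: "Poly_Mapping.lookup (hom_chain (m-1) ?c b {} j) 0 \<noteq> 0"
    using nontriv zigzag_trivial_last by blast
  have "j \<in> {1..\<beta> (m-1)}"
    using j koszul_chains_eq_0[OF zigzag_end[OF z], of "{}" j] by fastforce
  \<comment> \<open>The constant monomial has degree 0, so the degree of the component is that of
    the generator.\<close>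
  moreover have "int (C j (m-1)) = ?c"
    using j by (auto simp: hom_chain_def hom_part_def lookup_restrict_keys wdeg_def split: if_splits)
  ultimately show ?thesis by blast
qed

lemma card_last_degree:
  "card {j \<in> {1..\<beta> (m-1)}. int (C j (m-1)) = x} = of_bool (x - \<Sigma> \<in> pseudo_frobenius m d)"
proof (cases "x - \<Sigma> \<in> pseudo_frobenius m d")
  case True
  then obtain j where j: "j \<in> {1..\<beta> (m-1)}" "int (C j (m-1)) = x"
    using pseudo_frobenius_last_degree by force
  hence "{j \<in> {1..\<beta> (m-1)}. int (C j (m-1)) = x} = {j}"
    using inj_onD[OF last_degrees_inj] by auto
  thus ?thesis using True by simp
next
  case False
  hence "{j \<in> {1..\<beta> (m-1)}. int (C j (m-1)) = x} = {}"
    using last_degree_pseudo_frobenius by auto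
  hence "card {j \<in> {1..\<beta> (m-1)}. int (C j (m-1)) = x} = 0" by (simp only: card.empty)
  thus ?thesis using False by simp
qed

end

section \<open>The Hilbert series of the resolution\<close>

definition vec_scale :: "'k \<Rightarrow> (nat \<Rightarrow> ('k::field_char_0) mpol) \<Rightarrow> (nat \<Rightarrow> 'k mpol)" where
  "vec_scale s v j = Poly_Mapping.single 0 s * v j"

lemma lookup_vec_scale: "Poly_Mapping.lookup (vec_scale s v j) t = s * Poly_Mapping.lookup (v j) t"
  unfolding vec_scale_def using lookup_single_mult[of 0 s "v j" t] by simp

interpretation vec: vector_space "vec_scale :: 'k::field_char_0 \<Rightarrow> _"
  by unfold_locales
    (auto intro!: ext poly_mapping_eqI simp: lookup_vec_scale lookup_add algebra_simps)

interpretation upoly: vector_space "smult :: 'k::field_char_0 \<Rightarrow> _"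
  by unfold_locales (auto simp: smult_add_right smult_add_left)

interpretation vec_vec: vector_space_pair "vec_scale :: 'k::field_char_0 \<Rightarrow> _" vec_scale ..
interpretation vec_upoly: vector_space_pair "vec_scale :: 'k::field_char_0 \<Rightarrow> _" smult ..

lemma sum_fun_apply: "(\<Sum>x\<in>A. f x) j = (\<Sum>x\<in>A. f x j)"
  by (induction A rule: infinite_finite_induct) auto

lemma alternating_telescope:
  fixes r :: "nat \<Rightarrow> int"
  shows "(\<Sum>i<n. (-1) ^ i * (r i + r (Suc i))) = r 0 - (-1) ^ n * r n"
  by (induction n) (auto simp: algebra_simps)

context semigroup_resolution
begin

definition graded_piece :: "nat \<Rightarrow> int \<Rightarrow> (nat \<Rightarrow> 'k mpol) set" where
  "graded_piece i c = {v \<in> free_module m (\<beta> i). hom_part i c v = v}"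

definition graded_index :: "nat \<Rightarrow> int \<Rightarrow> (nat \<times> (nat \<Rightarrow>\<^sub>0 nat)) set" where
  "graded_index i c = Sigma {1..\<beta> i} (\<lambda>j. monomials_of_degree d {1..m} (c - int (C j i)))"

definition monomial_vec :: "nat \<times> (nat \<Rightarrow>\<^sub>0 nat) \<Rightarrow> nat \<Rightarrow> 'k mpol" where
  "monomial_vec p j = (if j = fst p then Poly_Mapping.single (snd p) 1 else 0)"

lemma graded_piece_iff:
  "v \<in> graded_piece i c \<longleftrightarrow> v \<in> free_module m (\<beta> i) \<and>
     (\<forall>j t. t \<in> Poly_Mapping.keys (v j) \<longrightarrow> int (wdeg m d t) + int (C j i) = c)"
proof -
  have "hom_part i c v = v \<longleftrightarrow>
     (\<forall>j t. t \<in> Poly_Mapping.keys (v j) \<longrightarrow> int (wdeg m d t) + int (C j i) = c)"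
    by (auto simp: fun_eq_iff poly_mapping_eq_iff hom_part_def lookup_restrict_keys in_keys_iff)
  thus ?thesis by (simp add: graded_piece_def)
qed

lemma finite_graded_index: "finite (graded_index i c)"
  unfolding graded_index_def using finite_monomials_of_degree[of "{1..m}" d] pos by auto

lemma graded_index_iff:
  "(j, t) \<in> graded_index i c \<longleftrightarrow>
    j \<in> {1..\<beta> i} \<and> Poly_Mapping.keys t \<subseteq> {1..m} \<and> int (wdeg m d t) + int (C j i) = c"
  unfolding graded_index_def monomials_of_degree_def wdeg_def by auto

lemma lookup_monomial_vec:
  "Poly_Mapping.lookup (monomial_vec p j) t = (if p = (j, t) then 1 else 0)"
  by (cases p) (auto simp: monomial_vec_def lookup_single when_def)

lemma monomial_vec_in: "monomial_vec p \<in> graded_piece i c" if "p \<in> graded_index i c"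
proof -
  obtain j t where p: "p = (j, t)" by (cases p)
  show ?thesis using that unfolding graded_piece_iff p graded_index_iff
    using poly_ring_single[of t m 1] by (auto simp: monomial_vec_def free_module_def)
qed

lemma inj_monomial_vec: "inj monomial_vec"
proof (rule injI)
  fix p q :: "nat \<times> (nat \<Rightarrow>\<^sub>0 nat)" assume "monomial_vec p = monomial_vec q"
  hence "Poly_Mapping.lookup (monomial_vec p (fst p)) (snd p) = Poly_Mapping.lookup (monomial_vec q (fst p)) (snd p)"
    by simp
  thus "p = q" unfolding lookup_monomial_vec by (auto split: if_splits)
qed

lemma independent_monomial_vec: "vec.independent (monomial_vec ` graded_index i c)"
proof (rule vec.independent_if_scalars_zero)
  show "finite (monomial_vec ` graded_index i c)" by (simp add: finite_graded_index)
  fix f v assume 0: "(\<Sum>v\<in>monomial_vec ` graded_index i c. vec_scale (f v) v) = 0"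
    and v: "v \<in> monomial_vec ` graded_index i c"
  obtain p where p: "p \<in> graded_index i c" "v = monomial_vec p" using v by blast
  have "0 = Poly_Mapping.lookup ((\<Sum>v\<in>monomial_vec ` graded_index i c. vec_scale (f v) v) (fst p)) (snd p)"
    using 0 by simp
  also have "\<dots> = (\<Sum>q\<in>graded_index i c. f (monomial_vec q) * (if q = p then 1 else 0))"
    by (simp add: sum.reindex[OF inj_on_subset[OF inj_monomial_vec]] sum_fun_apply lookup_sum
        lookup_vec_scale lookup_monomial_vec)
  also have "\<dots> = (\<Sum>q\<in>graded_index i c. if q = p then f (monomial_vec q) else 0)"
    by (intro sum.cong) auto
  also have "\<dots> = f v" using p finite_graded_index by simp
  finally show "f v = 0" ..
qed

lemma span_monomial_vec: "graded_piece i c \<subseteq> vec.span (monomial_vec ` graded_index i c)"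
proof
  fix v assume v: "v \<in> graded_piece i c"
  have "v = (\<Sum>p\<in>graded_index i c. vec_scale (Poly_Mapping.lookup (v (fst p)) (snd p)) (monomial_vec p))"
  proof (intro ext poly_mapping_eqI)
    fix j t
    have "Poly_Mapping.lookup ((\<Sum>p\<in>graded_index i c.
        vec_scale (Poly_Mapping.lookup (v (fst p)) (snd p)) (monomial_vec p)) j) t
      = (\<Sum>p\<in>graded_index i c. if p = (j, t) then Poly_Mapping.lookup (v j) t else 0)"
      unfolding sum_fun_apply lookup_sum lookup_vec_scale lookup_monomial_vec
      by (intro sum.cong) auto
    also have "\<dots> = (if (j, t) \<in> graded_index i c then Poly_Mapping.lookup (v j) t else 0)"
      using finite_graded_index by simp
    also have "\<dots> = Poly_Mapping.lookup (v j) t"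
    proof (cases "t \<in> Poly_Mapping.keys (v j)")
      case True
      have "v \<in> free_module m (\<beta> i)" "int (wdeg m d t) + int (C j i) = c"
        using v True unfolding graded_piece_iff by auto
      moreover have "j \<in> {1..\<beta> i}"
        using calculation(1) True unfolding free_module_def by fastforce
      moreover have "Poly_Mapping.keys t \<subseteq> {1..m}"
        using free_module_entry[OF calculation(1)] True unfolding poly_ring_def by blast
      ultimately show ?thesis by (simp add: graded_index_iff)
    qed (simp add: in_keys_iff)
    finally show "Poly_Mapping.lookup (v j) t = Poly_Mapping.lookup ((\<Sum>p\<in>graded_index i c.
        vec_scale (Poly_Mapping.lookup (v (fst p)) (snd p)) (monomial_vec p)) j) t" ..
  qed
  thus "v \<in> vec.span (monomial_vec ` graded_index i c)"
    by (metis (no_types, lifting) vec.span_sum vec.span_scale vec.span_base imageI)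
qed

lemma dim_graded_piece: "vec.dim (graded_piece i c) = card (graded_index i c)"
proof -
  have "card (monomial_vec ` graded_index i c) = vec.dim (graded_piece i c)"
    using monomial_vec_in
    by (intro vec.basis_card_eq_dim span_monomial_vec independent_monomial_vec) auto
  thus ?thesis using card_image[OF inj_on_subset[OF inj_monomial_vec]] by (metis subset_UNIV)
qed

lemma subspace_graded_piece: "vec.subspace (graded_piece i c)"
proof (rule vec.subspaceI)
  show "0 \<in> graded_piece i c" by (simp add: graded_piece_def)
next
  fix v w assume v: "v \<in> graded_piece i c" and w: "w \<in> graded_piece i c"
  have "v + w \<in> free_module m (\<beta> i)"
    using v w by (auto simp: graded_piece_def free_module_def intro!: poly_ring_add)
  moreover have "hom_part i c (v + w) = hom_part i c v + hom_part i c w"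
    by (intro ext) (simp add: hom_part_def restrict_keys_add)
  ultimately show "v + w \<in> graded_piece i c" using v w by (simp add: graded_piece_def)
next
  fix s v assume v: "v \<in> graded_piece i c"
  have "vec_scale s v \<in> free_module m (\<beta> i)"
    using v poly_ring_mult[OF poly_ring_single[of 0 m s]]
    by (auto simp: graded_piece_def free_module_def vec_scale_def)
  moreover have "hom_part i c (vec_scale s v) = vec_scale s (hom_part i c v)"
    by (intro ext poly_mapping_eqI) (auto simp: hom_part_def lookup_restrict_keys lookup_vec_scale)
  ultimately show "vec_scale s v \<in> graded_piece i c" using v by (simp add: graded_piece_def)
qed

lemma linear_D: "Vector_Spaces.linear vec_scale vec_scale (D i)"
proof -
  have "D i (v + w) = D i v + D i w" for v w
    using D_diff[of i "v + w" w] by (simp add: algebra_simps)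
  moreover have "D i (vec_scale s v) = vec_scale s (D i v)" for s v
    unfolding vec_scale_def D_def mat_map_mult ..
  ultimately show ?thesis
    by (simp add: Vector_Spaces.linear_iff vec.vector_space_axioms)
qed

lemma linear_subst_map: "Vector_Spaces.linear vec_scale smult (\<lambda>v. subst_map m d (v 1) :: 'k poly)"
proof -
  have "subst_map m d (vec_scale s v 1) = smult s (subst_map m d (v 1))" for s and v :: "nat \<Rightarrow> 'k mpol"
  proof -
    have "wdeg m d 0 = 0" by (simp add: wdeg_def)
    thus ?thesis by (simp add: vec_scale_def subst_map_mult subst_map_single monom_0)
  qed
  thus ?thesis
    by (simp add: Vector_Spaces.linear_iff vec.vector_space_axioms upoly.vector_space_axioms subst_map_add)
qed

text \<open>A preimage supplied by \<open>exact\<close> need not be homogeneous, but its component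
  of degree \<open>c\<close> has the same image.\<close>

lemma image_D_graded:
  assumes "i < m - 1"
  shows "D (Suc i) ` graded_piece (Suc i) c = {v \<in> graded_piece i c. cycle i v}"
proof (intro equalityI subsetI)
  fix v assume "v \<in> D (Suc i) ` graded_piece (Suc i) c"
  then obtain w where w: "w \<in> free_module m (\<beta> (Suc i))" "hom_part (Suc i) c w = w" "v = D (Suc i) w"
    by (auto simp: graded_piece_def)
  have "hom_part i c v = v"
    using D_hom_part[of "Suc i" c w] assms w by simp
  thus "v \<in> {v \<in> graded_piece i c. cycle i v}"
    using D_cycle[OF assms w(1)] w(3) by (simp add: graded_piece_def)
next
  fix v assume "v \<in> {v \<in> graded_piece i c. cycle i v}"
  hence v: "v \<in> free_module m (\<beta> i)" "hom_part i c v = v" "cycle i v" by (auto simp: graded_piece_def)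
  then obtain w where w: "w \<in> free_module m (\<beta> (Suc i))" "D (Suc i) w = v"
    using exact[OF assms] by blast
  have "D (Suc i) (hom_part (Suc i) c w) = v"
    using D_hom_part[of "Suc i" c w] assms w v by simp
  moreover have "hom_part (Suc i) c w \<in> graded_piece (Suc i) c"
    using hom_part_free[OF w(1)] 
    by (auto simp: graded_piece_def hom_part_def lookup_restrict_keys intro!: ext poly_mapping_eqI)
  ultimately show "v \<in> D (Suc i) ` graded_piece (Suc i) c" by blast
qed

lemma dim_image_subst_map:
  "upoly.dim ((\<lambda>v. subst_map m d (v 1) :: 'k poly) ` graded_piece 0 c) = of_bool (c \<in> S)"
proof (cases "c \<in> S")
  case True
  then obtain t where t: "Poly_Mapping.keys t \<subseteq> {1..m}" "int (wdeg m d t) = c"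
    using mem_iff_wdeg by blast
  let ?p = "monom 1 (wdeg m d t) :: 'k poly"
  have "monomial_vec (1, t) \<in> graded_piece 0 c"
    using t by (intro monomial_vec_in) (simp add: graded_index_iff)
  moreover have "subst_map m d (monomial_vec (1, t) 1) = ?p"
    by (simp add: monomial_vec_def subst_map_single)
  ultimately have "{?p} \<subseteq> (\<lambda>v. subst_map m d (v 1)) ` graded_piece 0 c"
    by (metis (mono_tags, lifting) empty_subsetI image_eqI insert_subset)
  moreover have "(\<lambda>v. subst_map m d (v 1)) ` graded_piece 0 c \<subseteq> upoly.span {?p}"
  proof
    fix q assume "q \<in> (\<lambda>v. subst_map m d (v 1) :: 'k poly) ` graded_piece 0 c"
    then obtain v where v: "v \<in> graded_piece 0 c" "q = subst_map m d (v 1)" by blast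
    have "q = monom (poly q 1) (wdeg m d t)"
      unfolding v(2) using v(1) t(2) by (intro subst_map_homogeneous) (force simp: graded_piece_iff)
    hence "q = smult (poly q 1) ?p" by (simp add: smult_monom)
    thus "q \<in> upoly.span {?p}" by (metis upoly.span_base upoly.span_scale singletonI)
  qed
  moreover have "upoly.independent {?p}"
    by (simp add: upoly.dependent_single)
  ultimately have "card {?p} = upoly.dim ((\<lambda>v. subst_map m d (v 1)) ` graded_piece 0 c)"
    by (rule upoly.basis_card_eq_dim)
  thus ?thesis using True by simp
next
  case False
  have "v = 0" if "v \<in> graded_piece 0 c" for v
  proof (intro ext)
    fix j
    have "t \<notin> Poly_Mapping.keys (v j)" for t
    proof
      assume t: "t \<in> Poly_Mapping.keys (v j)"
      have v: "v \<in> free_module m (\<beta> 0)" "int (wdeg m d t) + int (C j 0) = c"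
        using that t unfolding graded_piece_iff by auto
      hence "j = 1" using t unfolding free_module_def by fastforce
      hence "int (wdeg m d t) = c" using v(2) by simp
      moreover have "Poly_Mapping.keys t \<subseteq> {1..m}"
        using free_module_entry[OF v(1)] t unfolding poly_ring_def by blast
      ultimately show False using False mem_iff_wdeg by blast
    qed
    hence "Poly_Mapping.keys (v j) = {}" by blast
    thus "v j = 0 j" by simp
  qed
  moreover have "0 \<in> graded_piece 0 c" using vec.subspace_0[OF subspace_graded_piece] .
  ultimately have "graded_piece 0 c = {0}" by blast
  hence "(\<lambda>v. subst_map m d (v 1) :: 'k poly) ` graded_piece 0 c = {0}" by simp
  moreover have "card ({} :: 'k poly set) = upoly.dim {0 :: 'k poly}"
    by (rule upoly.basis_card_eq_dim) (auto simp: upoly.dependent_def)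
  ultimately show ?thesis using False by simp
qed

lemma euler_characteristic:
  "(\<Sum>i<m. (-1) ^ i * int (card (graded_index i c))) = of_bool (c \<in> S)"
proof -
  \<comment> \<open>The rank of the map out of the \<open>i\<close>-th module in degree
    \<open>c\<close>: \<open>r 0\<close> is the dimension of that degree of \<open>k[S]\<close>, and
    \<open>r m = 0\<close> expresses injectivity of the last map. Exactness makes the nullity at
    \<open>i\<close> equal to \<open>r (Suc i)\<close>.\<close>
  define r where "r = (\<lambda>i. if i = 0 then of_bool (c \<in> S) else if i < m
    then int (vec.dim (D i ` graded_piece i c)) else 0)"
  have "int (card (graded_index i c)) = r i + r (Suc i)" if i: "i < m" for i
  proof -
    have fin: "finite (monomial_vec ` graded_index i c)" by (simp add: finite_graded_index)
    have ker: "int (vec.dim {v \<in> graded_piece i c. cycle i v}) = r (Suc i)"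
    proof (cases "Suc i = m")
      case True
      have "{v \<in> graded_piece i c. cycle i v} = {0}"
      proof (intro equalityI subsetI)
        fix v assume "v \<in> {v \<in> graded_piece i c. cycle i v}"
        moreover have "i = m - 1" using True by simp
        ultimately show "v \<in> {0}" using last_injective by (auto simp: graded_piece_def)
      qed (simp add: cycle_zero graded_piece_def)
      moreover have "card ({} :: (nat \<Rightarrow> 'k mpol) set) = vec.dim {0 :: nat \<Rightarrow> 'k mpol}"
        by (rule vec.basis_card_eq_dim) (auto simp: vec.dependent_def)
      ultimately show ?thesis using True by (simp add: r_def)
    next
      case False
      thus ?thesis using i image_D_graded[of i c] by (simp add: r_def)
    qed
    show ?thesis
    proof (cases "i = 0")
      case True
      have "vec.dim (graded_piece i c) = upoly.dim ((\<lambda>v. subst_map m d (v 1) :: 'k poly) ` graded_piece i c)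
          + vec.dim {v \<in> graded_piece i c. subst_map m d (v 1) = 0}"
        by (rule vec_upoly.dim_eq_dim_image_plus_dim_kernel[OF linear_subst_map
          subspace_graded_piece span_monomial_vec fin])
      thus ?thesis using True ker dim_image_subst_map
        by (simp add: dim_graded_piece cycle_def r_def)
    next
      case False
      have "vec.dim (graded_piece i c) = vec.dim (D i ` graded_piece i c)
          + vec.dim {v \<in> graded_piece i c. D i v = 0}"
        by (rule vec_vec.dim_eq_dim_image_plus_dim_kernel[OF linear_D
          subspace_graded_piece span_monomial_vec fin])
      thus ?thesis using False i ker by (simp add: dim_graded_piece cycle_def r_def)
    qed
  qed
  hence "(\<Sum>i<m. (-1) ^ i * int (card (graded_index i c))) = (\<Sum>i<m. (-1) ^ i * (r i + r (Suc i)))"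
    by (intro sum.cong) auto
  also have "\<dots> = r 0 - (-1) ^ m * r m" by (rule alternating_telescope)
  finally show ?thesis using m_pos by (simp add: r_def)
qed

text \<open>Each generator spans a shifted copy of the polynomial ring, whose Hilbert series times
  the denominator is 1; so it contributes just its own signed monomial.\<close>

lemma hilbert_numerator:
  "alt_shift d {1..m} (\<lambda>y. of_bool (y \<in> S)) x
    = (\<Sum>i<m. (-1) ^ i * int (card {j \<in> {1..\<beta> i}. int (C j i) = x}))"
proof -
  let ?N = "\<lambda>y. int (card (monomials_of_degree d {1..m} y))"
  let ?K = "Sigma {..<m} (\<lambda>i. {1..\<beta> i})"
  have "of_bool (y \<in> S) = (\<Sum>p\<in>?K. (-1) ^ fst p * ?N (y - int (C (snd p) (fst p))))" for y
  proof -
    have "int (card (graded_index i y)) = (\<Sum>j=1..\<beta> i. ?N (y - int (C j i)))" for i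
      unfolding graded_index_def
      using finite_monomials_of_degree[of "{1..m}" d] pos by (subst card_SigmaI) auto
    thus ?thesis
      unfolding euler_characteristic[symmetric]
      by (simp add: sum_distrib_left sum.Sigma case_prod_unfold)
  qed
  hence "alt_shift d {1..m} (\<lambda>y. of_bool (y \<in> S)) x
     = alt_shift d {1..m} (\<lambda>y. \<Sum>p\<in>?K. (-1) ^ fst p * ?N (y - int (C (snd p) (fst p)))) x"
    by simp
  also have "\<dots> = (\<Sum>p\<in>?K. (-1) ^ fst p * alt_shift d {1..m} ?N (x - int (C (snd p) (fst p))))"
    by (rule alt_shift_sum)
  also have "\<dots> = (\<Sum>p\<in>?K. (-1) ^ fst p * of_bool (int (C (snd p) (fst p)) = x))"
    using alt_shift_card_monomials[of "{1..m}" d] pos by (intro sum.cong) auto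
  also have "\<dots> = (\<Sum>i<m. (-1) ^ i * (\<Sum>j=1..\<beta> i. of_bool (int (C j i) = x)))"
    unfolding sum_distrib_left by (subst sum.Sigma) (auto simp: case_prod_unfold)
  also have "\<dots> = (\<Sum>i<m. (-1) ^ i * int (card {j \<in> {1..\<beta> i}. int (C j i) = x}))"
    by (simp add: Int_def flip: of_nat_sum)
  finally show ?thesis .
qed

end

section \<open>Counting syzygy degrees\<close>

lemma count_image_mset_set:
  assumes "finite A"
  shows "count (image_mset f (mset_set A)) x = card {a \<in> A. f a = x}"
proof -
  have "f -` {x} \<inter> set_mset (mset_set A) = {a \<in> A. f a = x}" using assms by auto
  thus ?thesis using assms by (simp add: count_image_mset)
qed

lemma size_eq_size_inter_add_size_diff: "size M = size (M \<inter># N) + size (M - N)"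
proof -
  have "M = M \<inter># N + (M - N)" by (rule multiset_eqI) simp
  thus ?thesis by (metis size_union)
qed

lemma sum_alternating_even_length:
  fixes f :: "nat \<Rightarrow> int"
  assumes "1 \<le> n"
  shows "(\<Sum>i<2*n. (-1) ^ i * f i)
    = f 0 - f (2*n-1) + (\<Sum>i=1..n-1. f (2*i)) - (\<Sum>i=1..n-1. f (2*i-1))"
  using assms
proof (induction n rule: dec_induct)
  case base
  show ?case by (simp add: numeral_2_eq_2)
next
  case (step n)
  have "{1..n} = insert n {1..n-1}" using step.hyps by auto
  moreover have "n \<notin> {1..n-1}" using step.hyps by auto
  ultimately show ?case using step by simp
qed

lemma sum_sign_eq_even_minus_odd:
  fixes f :: "nat \<Rightarrow> int"
  assumes "finite A"
  shows "(\<Sum>i\<in>A. (-1) ^ i * f i) = (\<Sum>i\<in>{i\<in>A. even i}. f i) - (\<Sum>i\<in>{i\<in>A. odd i}. f i)"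
proof -
  have "(\<Sum>i\<in>A. (-1) ^ i * f i) = (\<Sum>i\<in>A. (if even i then f i else 0) - (if odd i then f i else 0))"
    by (intro sum.cong) auto
  thus ?thesis using assms by (simp add: sum_subtractf sum.inter_filter)
qed

lemma atMost_eq_insert_ends: "0 < m \<Longrightarrow> {..m} = insert 0 (insert m {1..m-1})" for m :: nat
  by auto

context numerical_semigroup
begin

lemma count_Lms:
  "int (count (Lms m d k) x)
    = (\<Sum>I\<in>{I. I \<subseteq> {1..m} \<and> card I = k}. of_bool (x - (\<Sum>j\<in>I. int (d j)) \<in> \<Delta>H m d))"
proof -
  let ?P = "{I. I \<subseteq> {1..m} \<and> card I = k}"
  have fin: "finite ?P" by (rule finite_subset[of _ "Pow {1..m}"]) auto
  have "{p \<in> ?P \<times> \<Delta>H m d. (case p of (I, h) \<Rightarrow> (\<Sum>j\<in>I. int (d j)) + h) = x}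
    = (\<lambda>I. (I, x - (\<Sum>j\<in>I. int (d j)))) ` {I \<in> ?P. x - (\<Sum>j\<in>I. int (d j)) \<in> \<Delta>H m d}"
    by (auto simp: image_iff algebra_simps)
  hence "count (Lms m d k) x = card {I \<in> ?P. x - (\<Sum>j\<in>I. int (d j)) \<in> \<Delta>H m d}"
    unfolding Lms_def using fin finite_\<Delta>H
    by (subst count_image_mset_set) (auto simp: card_image inj_on_def)
  thus ?thesis using fin by (simp add: Int_def)
qed

text \<open>Subsets are grouped by cardinality; since \<open>m\<close> is even, both
  \<open>{}\<close> and \<open>{1..m}\<close> carry a positive sign.\<close>

lemma alt_shift_\<Delta>H:
  assumes "0 < m" "even m"
  shows "alt_shift d {1..m} (\<lambda>y. of_bool (y \<in> \<Delta>H m d)) x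
    = of_bool (x \<in> \<Delta>H m d) + of_bool (x - gen_sum m d \<in> \<Delta>H m d)
      + int (count (Lms_even m d) x) - int (count (Lms_odd m d) x)"
proof -
  let ?l = "\<lambda>k. int (count (Lms m d k) x)"
  have empty: "{I. I \<subseteq> {1..m} \<and> card I = 0} = {{}}"
    by (auto simp: card_eq_0_iff dest: finite_subset[OF _ finite_atLeastAtMost])
  have full: "{I. I \<subseteq> {1..m} \<and> card I = m} = {{1..m}}"
  proof (intro equalityI subsetI)
    fix I assume "I \<in> {I. I \<subseteq> {1..m} \<and> card I = m}"
    hence "I = {1..m}" by (intro card_subset_eq) auto
    thus "I \<in> {{1..m}}" by simp
  qed auto
  have "alt_shift d {1..m} (\<lambda>y. of_bool (y \<in> \<Delta>H m d)) x
    = (\<Sum>k\<in>{..m}. \<Sum>I\<in>{I \<in> Pow {1..m}. card I = k}.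
         (-1) ^ card I * of_bool (x - (\<Sum>j\<in>I. int (d j)) \<in> \<Delta>H m d))"
    unfolding alt_shift_def using card_mono[of "{1..m}"] by (intro sum.group[symmetric]) auto
  also have "\<dots> = (\<Sum>k\<in>{..m}. (-1) ^ k * ?l k)"
    unfolding count_Lms sum_distrib_left by (intro sum.cong) auto
  also have "\<dots> = ?l 0 + (?l m + (\<Sum>k\<in>{1..m-1}. (-1) ^ k * ?l k))"
    using assms by (simp add: atMost_eq_insert_ends)
  also have "?l 0 = of_bool (x \<in> \<Delta>H m d)"
    unfolding count_Lms empty by simp
  also have "?l m = of_bool (x - gen_sum m d \<in> \<Delta>H m d)"
    unfolding count_Lms full by (simp add: gen_sum_def)
  also have "(\<Sum>k\<in>{1..m-1}. (-1) ^ k * ?l k)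
     = int (count (Lms_even m d) x) - int (count (Lms_odd m d) x)"
    unfolding Lms_even_def Lms_odd_def by (simp add: sum_sign_eq_even_minus_odd count_sum)
  finally show ?thesis by simp
qed

lemma size_Lms: "size (Lms m d k) = (m choose k) * \<gamma>H m d"
proof -
  have "{I. I \<subseteq> {1..m} \<and> card I = k} = {I \<in> Pow {1..m}. card I = k}" by auto
  thus ?thesis
    using n_subsets[of "{1..m}" k] by (simp add: Lms_def card_cartesian_product \<gamma>H_def)
qed

text \<open>Binomial coefficients of either parity sum to half of \<open>2 ^ m\<close>. The omitted
  ends 0 and \<open>m\<close> are both even, so only the even sum loses 2, doubled here to
  4.\<close>

lemma size_Lms_even: "2 * size (Lms_even m d) + 4 * \<gamma>H m d = 2 ^ m * \<gamma>H m d"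
  and size_Lms_odd: "2 * size (Lms_odd m d) = 2 ^ m * \<gamma>H m d"
  if m: "0 < m" "even m"
proof -
  have ends: "(\<Sum>i\<le>m. f i) = f 0 + (f m + (\<Sum>i\<in>{1..m-1}. f i))" for f :: "nat \<Rightarrow> nat"
    using m by (simp add: atMost_eq_insert_ends)
  have "size (Lms_even m d) = (\<Sum>i\<in>{i\<in>{1..m-1}. even i}. (m choose i)) * \<gamma>H m d"
    unfolding Lms_even_def by (simp add: size_Lms sum_distrib_right)
  hence "size (Lms_even m d) = (\<Sum>i\<in>{1..m-1}. if even i then m choose i else 0) * \<gamma>H m d"
    by (subst (asm) sum.inter_filter) auto
  moreover have "2 * (\<Sum>i\<le>m. if even i then m choose i else 0) = 2 ^ m"
  proof -
    have "int (\<Sum>i\<le>m. if even i then m choose i else 0) = (\<Sum>i\<le>m. if even i then int (m choose i) else 0)"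
      unfolding of_nat_sum by (intro sum.cong) auto
    hence "int (2 * (\<Sum>i\<le>m. if even i then m choose i else 0)) = int (2 ^ m)"
      using choose_even_sum[of m, where ?'a = int] m by simp
    thus ?thesis by (simp only: of_nat_eq_iff)
  qed
  hence "4 + 2 * (\<Sum>i\<in>{1..m-1}. if even i then m choose i else 0) = 2 ^ m"
    using m unfolding ends by simp
  hence "2 ^ m * \<gamma>H m d = (4 + 2 * (\<Sum>i\<in>{1..m-1}. if even i then m choose i else 0)) * \<gamma>H m d"
    by (simp only:)
  ultimately show "2 * size (Lms_even m d) + 4 * \<gamma>H m d = 2 ^ m * \<gamma>H m d"
    by (simp only: distrib_right mult.assoc add.commute)
  have "size (Lms_odd m d) = (\<Sum>i\<in>{i\<in>{1..m-1}. odd i}. (m choose i)) * \<gamma>H m d"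
    unfolding Lms_odd_def by (simp add: size_Lms sum_distrib_right)
  hence "size (Lms_odd m d) = (\<Sum>i\<in>{1..m-1}. if odd i then m choose i else 0) * \<gamma>H m d"
    by (subst (asm) sum.inter_filter) auto
  moreover have "2 * (\<Sum>i\<le>m. if odd i then m choose i else 0) = 2 ^ m"
  proof -
    have "int (\<Sum>i\<le>m. if odd i then m choose i else 0) = (\<Sum>i\<le>m. if odd i then int (m choose i) else 0)"
      unfolding of_nat_sum by (intro sum.cong) auto
    hence "int (2 * (\<Sum>i\<le>m. if odd i then m choose i else 0)) = int (2 ^ m)"
      using choose_odd_sum[of m, where ?'a = int] m by simp
    thus ?thesis by (simp only: of_nat_eq_iff)
  qed
  hence "2 * (\<Sum>i\<in>{1..m-1}. if odd i then m choose i else 0) = 2 ^ m"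
    using m unfolding ends by simp
  hence "2 ^ m * \<gamma>H m d = (2 * (\<Sum>i\<in>{1..m-1}. if odd i then m choose i else 0)) * \<gamma>H m d"
    by (simp only:)
  ultimately show "2 * size (Lms_odd m d) = 2 ^ m * \<gamma>H m d"
    by (simp only: distrib_right mult.assoc add.commute)
qed

end

context semigroup_resolution
begin

lemma count_Bms: "count (Bms \<beta> C i) x = card {j \<in> {1..\<beta> i}. int (C j i) = x}"
  unfolding Bms_def by (rule count_image_mset_set) simp

lemma count_Bms_bar: "count (Bms_bar m d \<beta> C i) x = count (Bms \<beta> C i) (F + \<Sigma> - x)"
proof -
  have "{j \<in> {1..\<beta> i}. F + \<Sigma> - int (C j i) = x} = {j \<in> {1..\<beta> i}. int (C j i) = F + \<Sigma> - x}"
    by auto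
  thus ?thesis unfolding count_Bms Bms_bar_def by (simp add: count_image_mset_set)
qed

lemma count_Bms_0: "count (Bms \<beta> C 0) x = of_bool (x = 0)"
  unfolding count_Bms by (cases "x = 0") (auto simp: card_1_singleton_iff intro!: exI[of _ 1])

text \<open>The two summands come from \<open>f = F\<close> and from \<open>f\<close> in
  \<open>\<Delta>H\<close>; they never meet, as \<open>F\<close> is not in
  \<open>\<Delta>H\<close>.\<close>

lemma count_Bms_last:
  assumes "almost_symmetric m d"
  shows "count (Bms \<beta> C (m-1)) x = of_bool (x = F + \<Sigma>) + of_bool (x - \<Sigma> \<in> \<Delta>H m d)"
  unfolding count_Bms card_last_degree pseudo_frobenius_eq(1)[OF assms]
  using pseudo_frobenius_eq(2)[OF assms] by (auto simp: algebra_simps)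

lemma hilbert_numerator_duality:
  assumes "even m"
  shows "alt_shift d {1..m} (\<lambda>y. of_bool (y \<in> S)) x + alt_shift d {1..m} (\<lambda>y. of_bool (y \<in> S)) (F + \<Sigma> - x)
     + alt_shift d {1..m} (\<lambda>y. of_bool (y \<in> \<Delta>H m d)) x = 0"
proof -
  have "(\<lambda>y. of_bool (y \<in> S)) = (\<lambda>y. (1 - of_bool (y \<in> \<Delta>H m d)) - of_bool (F - y \<in> S) :: int)"
    using mem_partition_reflect by (intro ext) (simp add: algebra_simps)
  hence "alt_shift d {1..m} (\<lambda>y. of_bool (y \<in> S)) x
     = alt_shift d {1..m} (\<lambda>y. (1 - of_bool (y \<in> \<Delta>H m d)) - of_bool (F - y \<in> S) :: int) x" by simp
  also have "\<dots> = - alt_shift d {1..m} (\<lambda>y. of_bool (y \<in> \<Delta>H m d)) x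
     - alt_shift d {1..m} (\<lambda>y. of_bool (F - y \<in> S)) x"
    using m_pos by (simp add: alt_shift_diff alt_shift_const)
  also have "alt_shift d {1..m} (\<lambda>y. of_bool (F - y \<in> S)) x
     = alt_shift d {1..m} (\<lambda>y. of_bool (y \<in> S)) (F + \<Sigma> - x)"
    using alt_shift_reflect[of "{1..m}" d "\<lambda>y. of_bool (y \<in> S)" F x] assms by (simp add: gen_sum_def)
  finally show ?thesis by simp
qed

lemma betti_multisets_balance:
  assumes m: "m = 2 * n" and sym: "almost_symmetric m d"
  shows "((\<Sum>i=1..n-1. Bms \<beta> C (2*i-1)) + (\<Sum>i=1..n-1. Bms_bar m d \<beta> C (2*i-1))) + Lms_odd m d
     = ((\<Sum>i=1..n-1. Bms \<beta> C (2*i)) + (\<Sum>i=1..n-1. Bms_bar m d \<beta> C (2*i))) + Lms_even m d"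
proof (rule multiset_eqI)
  fix x
  let ?q = "\<lambda>x. alt_shift d {1..m} (\<lambda>y. of_bool (y \<in> S)) x"
  let ?b = "\<lambda>i x. int (count (Bms \<beta> C i) x)"
  have n: "1 \<le> n" using m_ge m by simp
  have q: "?q y = ?b 0 y - ?b (m-1) y + (\<Sum>i=1..n-1. ?b (2*i) y) - (\<Sum>i=1..n-1. ?b (2*i-1) y)" for y
    using sum_alternating_even_length[OF n, of "\<lambda>i. ?b i y"] hilbert_numerator[of y]
    unfolding m[symmetric] count_Bms by simp
  let ?y = "F + \<Sigma> - x"
  have 0: "?b 0 x + ?b 0 ?y = of_bool (x = 0) + of_bool (x = F + \<Sigma>)"
    by (auto simp: count_Bms_0)
  have refl: "F - x \<in> \<Delta>H m d \<longleftrightarrow> x \<in> \<Delta>H m d" by (rule \<Delta>H_reflect)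
  have y: "?y - \<Sigma> = F - x" "?y = F + \<Sigma> \<longleftrightarrow> x = 0" by auto
  \<comment> \<open>Reflection swaps \<open>F + \<Sigma>\<close> with 0 and sends
    \<open>h + \<Sigma>\<close> to \<open>F - h\<close>, again in \<open>\<Delta>H\<close>. The
    first two terms cancel those in \<open>0\<close>, the last two the ends in
    \<open>alt_shift_\<Delta>H\<close>.\<close>
  have last: "?b (m-1) x + ?b (m-1) ?y = of_bool (x = 0) + of_bool (x = F + \<Sigma>)
     + of_bool (x \<in> \<Delta>H m d) + of_bool (x - \<Sigma> \<in> \<Delta>H m d)"
    unfolding count_Bms_last[OF sym] y refl by simp
  have "?q x + ?q ?y + alt_shift d {1..m} (\<lambda>y. of_bool (y \<in> \<Delta>H m d)) x = 0"
    by (rule hilbert_numerator_duality) (simp add: m)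
  hence "(\<Sum>i=1..n-1. ?b (2*i) x) - (\<Sum>i=1..n-1. ?b (2*i-1) x)
     + (\<Sum>i=1..n-1. ?b (2*i) ?y) - (\<Sum>i=1..n-1. ?b (2*i-1) ?y)
     + int (count (Lms_even m d) x) - int (count (Lms_odd m d) x) = 0"
    unfolding q using 0 last alt_shift_\<Delta>H[OF m_pos, of x] m by simp
  hence "int (count (((\<Sum>i=1..n-1. Bms \<beta> C (2*i-1)) + (\<Sum>i=1..n-1. Bms_bar m d \<beta> C (2*i-1))) + Lms_odd m d) x)
     = int (count (((\<Sum>i=1..n-1. Bms \<beta> C (2*i)) + (\<Sum>i=1..n-1. Bms_bar m d \<beta> C (2*i))) + Lms_even m d) x)"
    by (simp add: count_sum count_Bms_bar)
  thus "count (((\<Sum>i=1..n-1. Bms \<beta> C (2*i-1)) + (\<Sum>i=1..n-1. Bms_bar m d \<beta> C (2*i-1))) + Lms_odd m d) x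
     = count (((\<Sum>i=1..n-1. Bms \<beta> C (2*i)) + (\<Sum>i=1..n-1. Bms_bar m d \<beta> C (2*i))) + Lms_even m d) x"
    by simp
qed

lemma size_Bms: "size (Bms \<beta> C i) = \<beta> i" and size_Bms_bar: "size (Bms_bar m d \<beta> C i) = \<beta> i"
  by (simp_all add: Bms_def Bms_bar_def)

end

text \<open>At each point, \<open>M - N\<close> and \<open>L - L'\<close> are the positive parts of
  the same integer; removing the intersection from \<open>M\<close> or \<open>L\<close> leaves
  exactly these differences.\<close>

lemma size_diff_inter_balance:
  assumes "M + L' = N + L"
  shows "int (size M) - int (size (M \<inter># N)) = int (size L) - int (size (L \<inter># L'))"
proof -
  have "M - N = L - L'"
  proof (rule multiset_eqI)
    fix x
    have "count M x + count L' x = count N x + count L x"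
      using assms by (metis count_union)
    thus "count (M - N) x = count (L - L') x" by simp
  qed
  thus ?thesis
    using size_eq_size_inter_add_size_diff[of M N] size_eq_size_inter_add_size_diff[of L L'] by simp
qed

theorem theorem5:
  fixes n :: nat and d :: "nat \<Rightarrow> nat"
    and \<beta> :: "nat \<Rightarrow> nat" and C :: "nat \<Rightarrow> nat \<Rightarrow> nat"
    and \<phi> :: "nat \<Rightarrow> nat \<Rightarrow> nat \<Rightarrow> ('k::field_char_0) mpol"
  assumes "n \<ge> 2"
    and "minimally_generating (2*n) d"
    and "almost_symmetric (2*n) d"
    and "minimal_graded_free_resolution (2*n) d \<beta> C \<phi>"
    and "syzygy_degree_requirements (2*n) \<beta> C"
  shows "(\<Sum>i=1..n-1. real (\<beta> (2*i-1)))
           = real (\<gamma>H (2*n) d) * (4^(n-1) - 1) + real_of_int (delta n d \<beta> C) / 2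
       \<and> (\<Sum>i=1..n-1. real (\<beta> (2*i)))
           = real (\<gamma>H (2*n) d) * 4^(n-1) + real_of_int (delta n d \<beta> C) / 2"
proof -
  interpret semigroup_resolution "2 * n" d \<beta> C \<phi>
    using assms by unfold_locales (auto simp: minimally_generating_def)
  define M where "M = (\<Sum>i=1..n-1. Bms \<beta> C (2*i-1)) + (\<Sum>i=1..n-1. Bms_bar (2*n) d \<beta> C (2*i-1))"
  define N where "N = (\<Sum>i=1..n-1. Bms \<beta> C (2*i)) + (\<Sum>i=1..n-1. Bms_bar (2*n) d \<beta> C (2*i))"
  let ?Le = "Lms_even (2*n) d" and ?Lo = "Lms_odd (2*n) d"
  have balance: "M + ?Lo = N + ?Le"
    unfolding M_def N_def by (rule betti_multisets_balance[OF refl assms(3)])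
  have wp: "size (M \<inter># N) = wp n d \<beta> C" "size (N \<inter># M) = wp n d \<beta> C"
    by (simp_all add: M_def N_def wp_def subset_mset.inf_commute)
  have ell: "size (?Le \<inter># ?Lo) = ell n d" "size (?Lo \<inter># ?Le) = ell n d"
    by (simp_all add: ell_def subset_mset.inf_commute)
  have "(2::nat) ^ (2 * n) = 4 * 4 ^ (n - 1)"
    using assms(1) by (cases n) (simp_all add: power_mult)
  hence sizes: "2 * size ?Le + 4 * \<gamma>H (2*n) d = 4 * 4 ^ (n - 1) * \<gamma>H (2*n) d"
    "2 * size ?Lo = 4 * 4 ^ (n - 1) * \<gamma>H (2*n) d"
    using size_Lms_even size_Lms_odd assms(1) by simp_all
  have "real (size ?Le) = 2 * (real (\<gamma>H (2*n) d) * (4 ^ (n - 1) - 1))"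
    using arg_cong[OF sizes(1), of real] by (simp add: algebra_simps)
  moreover have "real (size ?Lo) = 2 * (real (\<gamma>H (2*n) d) * 4 ^ (n - 1))"
    using arg_cong[OF sizes(2), of real] by (simp add: algebra_simps)
  \<comment> \<open>Each Betti number is counted once for the degrees and once for their
    reflections.\<close>
  moreover have "size M = 2 * (\<Sum>i=1..n-1. \<beta> (2*i-1))" "size N = 2 * (\<Sum>i=1..n-1. \<beta> (2*i))"
    by (simp_all add: M_def N_def size_Bms size_Bms_bar)
  \<comment> \<open>In \<open>balance\<close> the odd \<open>L\<close> stands on the side of
    \<open>M\<close>, so the excess of \<open>M\<close> over \<open>N\<close> is that of the even
    \<open>L\<close> over the odd one.\<close>
  moreover have "real (size M) = real (size ?Le) + real_of_int (delta n d \<beta> C)"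
    using size_diff_inter_balance[OF balance] unfolding wp ell delta_def by linarith
  moreover have "real (size N) = real (size ?Lo) + real_of_int (delta n d \<beta> C)"
    using size_diff_inter_balance[OF balance[symmetric]] unfolding wp ell delta_def by linarith
  ultimately show ?thesis by (simp add: field_simps)
qed

end
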